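(* Let $X$ be a metric space and let $\mathcal G$ be a metric group. The Grothendieck construction functor $E:\mathsf{PMet}_X^{\mathcal G}\to\mathsf{Tors}_X^{\mathcal G}$, from the category of $\mathcal G$-metric actions to the category of $\mathcal G$-torsors over $X$, is an equivalence of categories.
   Context: A Lipschitz map between metric spaces is a map $f$ with $d(fx,fx')\le d(x,x')$ (constant $1$). An isometry is a distance-preserving bijection. A metric group is a group $\mathcal G$ with a metric $d_{\mathcal G}$ such that multiplication $\mathcal G\times\mathcal G\to\mathcal G$ is Lipschitz for the $L^1$-product metric $d((g,h),(g',h'))=d(g,g')+d(h,h')$. Such a metric is automatically left and right invariant. A $\mathcal G$-metric action $F$ on $X$ assigns to every $x\in X$ the metric space $Fx=\mathcal G$ and to all $x,x'\in X$ the left multiplication $F_{xx'}:\mathcal G\to\mathcal G$ by some element $f_{xx'}\in\mathcal G$, such that for all $x,x',x''\in X$: $F_{xx}=\mathrm{id}$, $F_{x'x}=F_{xx'}^{-1}$, and $d_{\mathcal G}(F_{x'x''}F_{xx'}a,F_{xx''}a)\le d_X(x,x')+d_X(x',x'')-d_X(x,x'')$ for every $a\in\mathcal G$. A $\mathcal G$-metric transformation $\theta:F\Rightarrow F'$ is a family of maps $\theta_x:Fx\to F'x$ ($x\in X$), each a left multiplication by an element of $\mathcal G$ also denoted $\theta_x$, with $F'_{xx'}\theta_x=\theta_{x'}F_{xx'}$ for all $x,x'$; composition is componentwise. $\mathsf{PMet}_X^{\mathcal G}$ is the resulting category. A metric fibration over $X$ is a Lipschitz map $\pi:E\to X$ of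 metric spaces such that for all $\varepsilon\in E$, $x\in X$ there is a unique $\varepsilon_x\in\pi^{-1}x$ with $d_E(\varepsilon,\varepsilon_x)=d_X(\pi\varepsilon,x)$ and $d_E(\varepsilon,\varepsilon')=d_E(\varepsilon,\varepsilon_x)+d_E(\varepsilon_x,\varepsilon')$ for all $\varepsilon'\in\pi^{-1}x$. A morphism of metric fibrations over $X$ is a Lipschitz map commuting with the projections to $X$. For a group $G$, a metric space $Y$ with a right $G$-action is a right $G$-torsor if the action is free and transitive (on a nonempty space), each $g\in G$ acts by an isometry, and $d_Y(y,yg)=d_Y(y',y'g)$ for all $y,y'\in Y$, $g\in G$. A metric fibration $\pi:E\to X$ is a $G$-torsor over $X$ if $G$ acts isometrically on $E$ from the right preserving each fiber of $\pi$, and each fiber is a right $G$-torsor for this action. Then $d_G(f,g)=d_E(\varepsilon f,\varepsilon g)$ ($\varepsilon\in E$) does not depend on $\varepsilon$ and makes $G$ a metric group. When this metric group is $\mathcal G$ one speaks of a $\mathcal G$-torsor over $X$. A $\mathcal G$-morphism of $\mathcal G$-torsors over $X$ is a $\mathcal G$-equivariant morphism of metric fibrations. $\mathsf{Tors}_X^{\mathcal G}$ is the category of $\mathcal G$-torsors over $X$ and $\mathcal G$-morphisms. Grothendieck construction: $E(F)=\{(x,g)\mid x\in X,\ g\in\mathcal G\}$ with $d_{E(F)}((x,g),(x',g'))=d_X(x,x')+d_{\mathcal G}(f_{xx'}g,g')$, projection $(x,g)\mapsto x$, and right action $(x,g)h=(x,gh)$; a $\mathcal G$-metric transformation $\theta$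 is sent to $(x,g)\mapsto(x,\theta_xg)$. *)

theory Defs
  imports "HOL-Analysis.Abstract_Metric_Spaces" "HOL-Algebra.Group"
begin

section \<open>Categories, functors, equivalences\<close>

text \<open>Arrows are stored in hom-sets indexed by source and target; \<open>cmp C a b c g f\<close> is the
  composite \<open>a \<rightarrow> b \<rightarrow> c\<close> of \<open>f\<close> followed by \<open>g\<close>. Hom-sets of different pairs of objects need
  not be disjoint.\<close>

record ('o, 'a) cat =
  obj :: "'o set"
  arr :: "'o \<Rightarrow> 'o \<Rightarrow> 'a set"
  ide :: "'o \<Rightarrow> 'a"
  cmp :: "'o \<Rightarrow> 'o \<Rightarrow> 'o \<Rightarrow> 'a \<Rightarrow> 'a \<Rightarrow> 'a"

definition is_category :: "('o, 'a) cat \<Rightarrow> bool" where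
  "is_category C \<longleftrightarrow>
    (\<forall>a\<in>obj C. ide C a \<in> arr C a a) \<and>
    (\<forall>a\<in>obj C. \<forall>b\<in>obj C. \<forall>c\<in>obj C. \<forall>f\<in>arr C a b. \<forall>g\<in>arr C b c. cmp C a b c g f \<in> arr C a c) \<and>
    (\<forall>a\<in>obj C. \<forall>b\<in>obj C. \<forall>f\<in>arr C a b.
       cmp C a a b f (ide C a) = f \<and> cmp C a b b (ide C b) f = f) \<and>
    (\<forall>a\<in>obj C. \<forall>b\<in>obj C. \<forall>c\<in>obj C. \<forall>d\<in>obj C.
       \<forall>f\<in>arr C a b. \<forall>g\<in>arr C b c. \<forall>h\<in>arr C c d.
         cmp C a c d h (cmp C a b c g f) = cmp C a b d (cmp C b c d h g) f)"

definition is_iso :: "('o, 'a) cat \<Rightarrow> 'o \<Rightarrow> 'o \<Rightarrow> 'a \<Rightarrow> bool" where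
  "is_iso C a b f \<longleftrightarrow> f \<in> arr C a b \<and>
    (\<exists>g\<in>arr C b a. cmp C a b a g f = ide C a \<and> cmp C b a b f g = ide C b)"

record ('o1, 'a1, 'o2, 'a2) func =
  fobj :: "'o1 \<Rightarrow> 'o2"
  farr :: "'o1 \<Rightarrow> 'o1 \<Rightarrow> 'a1 \<Rightarrow> 'a2"

definition is_functor ::
  "('o1, 'a1) cat \<Rightarrow> ('o2, 'a2) cat \<Rightarrow> ('o1, 'a1, 'o2, 'a2) func \<Rightarrow> bool" where
  "is_functor C D F \<longleftrightarrow> is_category C \<and> is_category D \<and>
    (\<forall>a\<in>obj C. fobj F a \<in> obj D) \<and>
    (\<forall>a\<in>obj C. \<forall>b\<in>obj C. \<forall>f\<in>arr C a b. farr F a b f \<in> arr D (fobj F a) (fobj F b)) \<and>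
    (\<forall>a\<in>obj C. farr F a a (ide C a) = ide D (fobj F a)) \<and>
    (\<forall>a\<in>obj C. \<forall>b\<in>obj C. \<forall>c\<in>obj C. \<forall>f\<in>arr C a b. \<forall>g\<in>arr C b c.
       farr F a c (cmp C a b c g f)
         = cmp D (fobj F a) (fobj F b) (fobj F c) (farr F b c g) (farr F a b f))"

definition id_func :: "('o, 'a, 'o, 'a) func" where
  "id_func = \<lparr>fobj = (\<lambda>a. a), farr = (\<lambda>a b f. f)\<rparr>"

definition comp_func ::
  "('o2, 'a2, 'o3, 'a3) func \<Rightarrow> ('o1, 'a1, 'o2, 'a2) func \<Rightarrow> ('o1, 'a1, 'o3, 'a3) func" where
  "comp_func K F = \<lparr>fobj = (\<lambda>a. fobj K (fobj F a)),
     farr = (\<lambda>a b f. farr K (fobj F a) (fobj F b) (farr F a b f))\<rparr>"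

definition naturally_isomorphic ::
  "('o1, 'a1) cat \<Rightarrow> ('o2, 'a2) cat \<Rightarrow>
   ('o1, 'a1, 'o2, 'a2) func \<Rightarrow> ('o1, 'a1, 'o2, 'a2) func \<Rightarrow> bool" where
  "naturally_isomorphic C D F F' \<longleftrightarrow>
    (\<exists>\<eta>. (\<forall>a\<in>obj C. is_iso D (fobj F a) (fobj F' a) (\<eta> a)) \<and>
         (\<forall>a\<in>obj C. \<forall>b\<in>obj C. \<forall>f\<in>arr C a b.
            cmp D (fobj F a) (fobj F b) (fobj F' b) (\<eta> b) (farr F a b f)
              = cmp D (fobj F a) (fobj F' a) (fobj F' b) (farr F' a b f) (\<eta> a)))"

definition is_equivalence ::
  "('o1, 'a1) cat \<Rightarrow> ('o2, 'a2) cat \<Rightarrow> ('o1, 'a1, 'o2, 'a2) func \<Rightarrow> bool" where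
  "is_equivalence C D F \<longleftrightarrow> is_functor C D F \<and>
    (\<exists>K. is_functor D C K \<and>
         naturally_isomorphic C C (comp_func K F) id_func \<and>
         naturally_isomorphic D D (comp_func F K) id_func)"

section \<open>Metric spaces and metric groups\<close>

text \<open>Only constant 1 is allowed, in contrast to \<open>Lipschitz_continuous_map\<close>.\<close>

definition lipschitz1 :: "'a metric \<Rightarrow> 'b metric \<Rightarrow> ('a \<Rightarrow> 'b) \<Rightarrow> bool" where
  "lipschitz1 M N f \<longleftrightarrow> f \<in> mspace M \<rightarrow> mspace N \<and>
    (\<forall>x\<in>mspace M. \<forall>y\<in>mspace M. mdist N (f x) (f y) \<le> mdist M x y)"

definition isometry :: "'a metric \<Rightarrow> 'b metric \<Rightarrow> ('a \<Rightarrow> 'b) \<Rightarrow> bool" where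
  "isometry M N f \<longleftrightarrow> bij_betw f (mspace M) (mspace N) \<and>
    (\<forall>x\<in>mspace M. \<forall>y\<in>mspace M. mdist N (f x) (f y) = mdist M x y)"

text \<open>The library's \<open>prod_metric\<close> is the Euclidean one.\<close>

definition l1_prod_metric :: "'a metric \<Rightarrow> 'b metric \<Rightarrow> ('a \<times> 'b) metric" where
  "l1_prod_metric M N = metric (mspace M \<times> mspace N,
     \<lambda>p q. mdist M (fst p) (fst q) + mdist N (snd p) (snd q))"

lemma l1_prod_metric_simps [simp]:
  "mspace (l1_prod_metric M N) = mspace M \<times> mspace N"
  "mdist (l1_prod_metric M N) p q = mdist M (fst p) (fst q) + mdist N (snd p) (snd q)"
proof -
  interpret Metric_space "mspace M \<times> mspace N"
    "\<lambda>p q. mdist M (fst p) (fst q) + mdist N (snd p) (snd q)"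
  proof
    fix x y z assume "x \<in> mspace M \<times> mspace N" "y \<in> mspace M \<times> mspace N"
      "z \<in> mspace M \<times> mspace N"
    then have "mdist M (fst x) (fst z) \<le> mdist M (fst x) (fst y) + mdist M (fst y) (fst z)"
      "mdist N (snd x) (snd z) \<le> mdist N (snd x) (snd y) + mdist N (snd y) (snd z)"
      by (auto intro!: mdist_triangle)
    then show "mdist M (fst x) (fst z) + mdist N (snd x) (snd z)
      \<le> mdist M (fst x) (fst y) + mdist N (snd x) (snd y)
        + (mdist M (fst y) (fst z) + mdist N (snd y) (snd z))"
      by linarith
  qed (auto simp: mdist_commute add_nonneg_eq_0_iff prod_eq_iff)
  show "mspace (l1_prod_metric M N) = mspace M \<times> mspace N"
    "mdist (l1_prod_metric M N) p q = mdist M (fst p) (fst q) + mdist N (snd p) (snd q)"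
    by (simp_all add: l1_prod_metric_def)
qed

definition metric_group :: "('g, 'b) monoid_scheme \<Rightarrow> 'g metric \<Rightarrow> bool" where
  "metric_group G D \<longleftrightarrow> group G \<and> mspace D = carrier G \<and>
    lipschitz1 (l1_prod_metric D D) D (\<lambda>(g, h). g \<otimes>\<^bsub>G\<^esub> h)"

section \<open>Metric actions\<close>

text \<open>Here and below, functions that are part of an object or an arrow are extensional
  (\<^const>\<open>restrict\<close>, \<^const>\<open>extensional\<close>), so that HOL equality is equality as set-theoretic
  functions on the domain in question.\<close>

definition left_mult :: "('g, 'b) monoid_scheme \<Rightarrow> 'g \<Rightarrow> 'g \<Rightarrow> 'g" where
  "left_mult G f = (\<lambda>a\<in>carrier G. f \<otimes>\<^bsub>G\<^esub> a)"

text \<open>\<open>F x x'\<close> is the map \<open>F\<^bsub>xx'\<^esub>\<close> from \<open>F x\<close> to \<open>F x'\<close>, both of these being the metric group.\<close>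

definition metric_action ::
  "'x metric \<Rightarrow> ('g, 'b) monoid_scheme \<Rightarrow> 'g metric \<Rightarrow> ('x \<Rightarrow> 'x \<Rightarrow> 'g \<Rightarrow> 'g) \<Rightarrow> bool" where
  "metric_action X G D F \<longleftrightarrow>
    F \<in> extensional (mspace X) \<and> (\<forall>x\<in>mspace X. F x \<in> extensional (mspace X)) \<and>
    (\<forall>x\<in>mspace X. \<forall>x'\<in>mspace X. \<exists>f\<in>carrier G. F x x' = left_mult G f) \<and>
    (\<forall>x\<in>mspace X. \<forall>a\<in>carrier G. F x x a = a) \<and>
    (\<forall>x\<in>mspace X. \<forall>x'\<in>mspace X. \<forall>a\<in>carrier G. F x' x a = inv_into (carrier G) (F x x') a) \<and>
    (\<forall>x\<in>mspace X. \<forall>x'\<in>mspace X. \<forall>x''\<in>mspace X. \<forall>a\<in>carrier G.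
       mdist D (F x' x'' (F x x' a)) (F x x'' a)
         \<le> mdist X x x' + mdist X x' x'' - mdist X x x'')"

definition metric_transformation ::
  "'x metric \<Rightarrow> ('g, 'b) monoid_scheme \<Rightarrow> ('x \<Rightarrow> 'x \<Rightarrow> 'g \<Rightarrow> 'g) \<Rightarrow> ('x \<Rightarrow> 'x \<Rightarrow> 'g \<Rightarrow> 'g) \<Rightarrow>
   ('x \<Rightarrow> 'g \<Rightarrow> 'g) \<Rightarrow> bool" where
  "metric_transformation X G F F' \<theta> \<longleftrightarrow>
    \<theta> \<in> extensional (mspace X) \<and>
    (\<forall>x\<in>mspace X. \<exists>t\<in>carrier G. \<theta> x = left_mult G t) \<and>
    (\<forall>x\<in>mspace X. \<forall>x'\<in>mspace X. \<forall>a\<in>carrier G. F' x x' (\<theta> x a) = \<theta> x' (F x x' a))"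

definition PMet ::
  "'x metric \<Rightarrow> ('g, 'b) monoid_scheme \<Rightarrow> 'g metric \<Rightarrow>
   ('x \<Rightarrow> 'x \<Rightarrow> 'g \<Rightarrow> 'g, 'x \<Rightarrow> 'g \<Rightarrow> 'g) cat" where
  "PMet X G D = \<lparr>
     obj = {F. metric_action X G D F},
     arr = (\<lambda>F F'. {\<theta>. metric_transformation X G F F' \<theta>}),
     ide = (\<lambda>F. \<lambda>x\<in>mspace X. \<lambda>a\<in>carrier G. a),
     cmp = (\<lambda>F F' F'' \<theta>' \<theta>. \<lambda>x\<in>mspace X. compose (carrier G) (\<theta>' x) (\<theta> x))\<rparr>"

section \<open>Metric fibrations and torsors\<close>

definition fiber :: "'e metric \<Rightarrow> ('e \<Rightarrow> 'x) \<Rightarrow> 'x \<Rightarrow> 'e set" where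
  "fiber E \<pi> x = {e \<in> mspace E. \<pi> e = x}"

definition metric_fibration :: "'x metric \<Rightarrow> 'e metric \<Rightarrow> ('e \<Rightarrow> 'x) \<Rightarrow> bool" where
  "metric_fibration X E \<pi> \<longleftrightarrow> lipschitz1 E X \<pi> \<and>
    (\<forall>e\<in>mspace E. \<forall>x\<in>mspace X. \<exists>!ex. ex \<in> fiber E \<pi> x \<and>
       mdist E e ex = mdist X (\<pi> e) x \<and>
       (\<forall>e'\<in>fiber E \<pi> x. mdist E e e' = mdist E e ex + mdist E ex e'))"

definition right_action :: "('g, 'b) monoid_scheme \<Rightarrow> 'y set \<Rightarrow> ('y \<Rightarrow> 'g \<Rightarrow> 'y) \<Rightarrow> bool" where
  "right_action G Y act \<longleftrightarrow>
    (\<forall>y\<in>Y. \<forall>g\<in>carrier G. act y g \<in> Y) \<and>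
    (\<forall>y\<in>Y. act y \<one>\<^bsub>G\<^esub> = y) \<and>
    (\<forall>y\<in>Y. \<forall>g\<in>carrier G. \<forall>h\<in>carrier G. act y (g \<otimes>\<^bsub>G\<^esub> h) = act (act y g) h)"

definition right_torsor :: "('g, 'b) monoid_scheme \<Rightarrow> 'y metric \<Rightarrow> ('y \<Rightarrow> 'g \<Rightarrow> 'y) \<Rightarrow> bool" where
  "right_torsor G Y act \<longleftrightarrow>
    right_action G (mspace Y) act \<and>
    mspace Y \<noteq> {} \<and>
    (\<forall>y\<in>mspace Y. \<forall>g\<in>carrier G. act y g = y \<longrightarrow> g = \<one>\<^bsub>G\<^esub>) \<and>
    (\<forall>y\<in>mspace Y. \<forall>y'\<in>mspace Y. \<exists>g\<in>carrier G. act y g = y') \<and>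
    (\<forall>g\<in>carrier G. isometry Y Y (\<lambda>y. act y g)) \<and>
    (\<forall>y\<in>mspace Y. \<forall>y'\<in>mspace Y. \<forall>g\<in>carrier G.
       mdist Y y (act y g) = mdist Y y' (act y' g))"

record ('x, 'g, 'e) torsor =
  total :: "'e metric"
  proj :: "'e \<Rightarrow> 'x"
  act :: "'e \<Rightarrow> 'g \<Rightarrow> 'e"

text \<open>The last conjunct says that the metric which the torsor induces on the group is the given
  one.\<close>

definition torsor_over ::
  "'x metric \<Rightarrow> ('g, 'b) monoid_scheme \<Rightarrow> 'g metric \<Rightarrow> ('x, 'g, 'e) torsor \<Rightarrow> bool" where
  "torsor_over X G D T \<longleftrightarrow>
    proj T \<in> extensional (mspace (total T)) \<and>
    act T \<in> extensional (mspace (total T)) \<and>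
    (\<forall>e\<in>mspace (total T). act T e \<in> extensional (carrier G)) \<and>
    metric_fibration X (total T) (proj T) \<and>
    right_action G (mspace (total T)) (act T) \<and>
    (\<forall>g\<in>carrier G. isometry (total T) (total T) (\<lambda>e. act T e g)) \<and>
    (\<forall>e\<in>mspace (total T). \<forall>g\<in>carrier G. proj T (act T e g) = proj T e) \<and>
    (\<forall>x\<in>mspace X. right_torsor G (submetric (total T) (fiber (total T) (proj T) x)) (act T)) \<and>
    (\<forall>e\<in>mspace (total T). \<forall>f\<in>carrier G. \<forall>g\<in>carrier G.
       mdist D f g = mdist (total T) (act T e f) (act T e g))"

definition torsor_morphism ::
  "('g, 'b) monoid_scheme \<Rightarrow> ('x, 'g, 'e) torsor \<Rightarrow> ('x, 'g, 'e) torsor \<Rightarrow> ('e \<Rightarrow> 'e) \<Rightarrow> bool" where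
  "torsor_morphism G T T' \<phi> \<longleftrightarrow>
    \<phi> \<in> extensional (mspace (total T)) \<and>
    lipschitz1 (total T) (total T') \<phi> \<and>
    (\<forall>e\<in>mspace (total T). proj T' (\<phi> e) = proj T e) \<and>
    (\<forall>e\<in>mspace (total T). \<forall>g\<in>carrier G. \<phi> (act T e g) = act T' (\<phi> e) g)"

text \<open>The total spaces of the objects are all metric spaces whose points are taken from the type
  \<open>'e\<close>, which plays the role of a universe.\<close>

definition Tors ::
  "'x metric \<Rightarrow> ('g, 'b) monoid_scheme \<Rightarrow> 'g metric \<Rightarrow> (('x, 'g, 'e) torsor, 'e \<Rightarrow> 'e) cat" where
  "Tors X G D = \<lparr>
     obj = {T. torsor_over X G D T},
     arr = (\<lambda>T T'. {\<phi>. torsor_morphism G T T' \<phi>}),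
     ide = (\<lambda>T. \<lambda>e\<in>mspace (total T). e),
     cmp = (\<lambda>T T' T'' \<psi> \<phi>. compose (mspace (total T)) \<psi> \<phi>)\<rparr>"

section \<open>The Grothendieck construction\<close>

text \<open>Distances involving points off the carrier are irrelevant, but \<^locale>\<open>Metric_space\<close> demands
  symmetry there as well; hence the conditional.\<close>

definition groth ::
  "'x metric \<Rightarrow> ('g, 'b) monoid_scheme \<Rightarrow> 'g metric \<Rightarrow> ('x \<Rightarrow> 'x \<Rightarrow> 'g \<Rightarrow> 'g) \<Rightarrow>
   ('x, 'g, 'x \<times> 'g) torsor" where
  "groth X G D F = \<lparr>
     total = metric (mspace X \<times> carrier G,
       \<lambda>p q. if p \<in> mspace X \<times> carrier G \<and> q \<in> mspace X \<times> carrier G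
              then mdist X (fst p) (fst q) + mdist D (F (fst p) (fst q) (snd p)) (snd q) else 0),
     proj = (\<lambda>p\<in>mspace X \<times> carrier G. fst p),
     act = (\<lambda>p\<in>mspace X \<times> carrier G. \<lambda>h\<in>carrier G. (fst p, snd p \<otimes>\<^bsub>G\<^esub> h))\<rparr>"

lemma metric_group_left_mult:
  assumes "metric_group G D" "f \<in> carrier G" "a \<in> carrier G" "b \<in> carrier G"
  shows "mdist D (f \<otimes>\<^bsub>G\<^esub> a) (f \<otimes>\<^bsub>G\<^esub> b) = mdist D a b"
proof -
  interpret group G using assms by (simp add: metric_group_def)
  have sp: "mspace D = carrier G" using assms by (simp add: metric_group_def)
  have *: "mdist D (h \<otimes>\<^bsub>G\<^esub> u) (h \<otimes>\<^bsub>G\<^esub> v) \<le> mdist D u v"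
    if "h \<in> carrier G" "u \<in> carrier G" "v \<in> carrier G" for h u v
  proof -
    have "mdist D h h = 0" using that sp by simp
    moreover have "mdist D (h \<otimes>\<^bsub>G\<^esub> u) (h \<otimes>\<^bsub>G\<^esub> v) \<le> mdist D h h + mdist D u v"
      using assms(1) that unfolding metric_group_def lipschitz1_def by fastforce
    ultimately show ?thesis by simp
  qed
  have "mdist D (inv\<^bsub>G\<^esub> f \<otimes>\<^bsub>G\<^esub> (f \<otimes>\<^bsub>G\<^esub> a)) (inv\<^bsub>G\<^esub> f \<otimes>\<^bsub>G\<^esub> (f \<otimes>\<^bsub>G\<^esub> b))
      \<le> mdist D (f \<otimes>\<^bsub>G\<^esub> a) (f \<otimes>\<^bsub>G\<^esub> b)"
    using assms by (intro *) auto
  then have "mdist D a b \<le> mdist D (f \<otimes>\<^bsub>G\<^esub> a) (f \<otimes>\<^bsub>G\<^esub> b)"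
    using assms by (simp add: m_assoc [symmetric])
  with * [of f a b] assms show ?thesis by simp
qed

lemma metric_action_facts:
  assumes "metric_group G D" "metric_action X G D F" "x \<in> mspace X" "x' \<in> mspace X"
    and ab: "a \<in> carrier G" "b \<in> carrier G"
  shows "F x x' a \<in> carrier G"
    and "mdist D (F x x' a) (F x x' b) = mdist D a b"
    and "F x x' (F x' x a) = a"
proof -
  interpret group G using assms by (simp add: metric_group_def)
  obtain f where f: "f \<in> carrier G" "F x x' = left_mult G f"
    using assms unfolding metric_action_def by meson
  show "F x x' a \<in> carrier G" using f ab by (simp add: left_mult_def)
  show "mdist D (F x x' a) (F x x' b) = mdist D a b"
    using f ab metric_group_left_mult [OF assms(1)] by (simp add: left_mult_def)
  have "F x x' ` carrier G = carrier G"
    using f by (simp add: left_mult_def surj_const_mult)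
  moreover have "F x' x a = inv_into (carrier G) (F x x') a"
    using assms unfolding metric_action_def by simp
  ultimately show "F x x' (F x' x a) = a" using ab by (simp add: f_inv_into_f)
qed

text \<open>The data in \<^const>\<open>groth\<close> do form a metric space, so \<^const>\<open>total\<close> is as intended.\<close>

lemma groth_total:
  assumes "metric_group G D" "metric_action X G D F"
  shows "mspace (total (groth X G D F)) = mspace X \<times> carrier G"
    and "\<lbrakk>x \<in> mspace X; x' \<in> mspace X; g \<in> carrier G; g' \<in> carrier G\<rbrakk> \<Longrightarrow>
      mdist (total (groth X G D F)) (x, g) (x', g') = mdist X x x' + mdist D (F x x' g) g'"
proof -
  note facts = metric_action_facts [OF assms]
  have sp: "mspace D = carrier G" using assms by (simp add: metric_group_def)
  let ?S = "mspace X \<times> carrier G"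
  let ?d = "\<lambda>p q. if p \<in> ?S \<and> q \<in> ?S
     then mdist X (fst p) (fst q) + mdist D (F (fst p) (fst q) (snd p)) (snd q) else 0"
  have sym: "mdist D (F x x' g) g' = mdist D (F x' x g') g"
    if "x \<in> mspace X" "x' \<in> mspace X" "g \<in> carrier G" "g' \<in> carrier G" for x x' g g'
    by (metis facts mdist_commute that)
  interpret Metric_space ?S ?d
  proof
    show "?d p q = ?d q p" for p q
      using sym [of "fst p" "fst q" "snd p" "snd q"]
      by (cases p; cases q) (auto simp: mdist_commute)
  next
    fix p q assume pq: "p \<in> ?S" "q \<in> ?S"
    have "F x x a = a" if "x \<in> mspace X" "a \<in> carrier G" for x a
      using assms that unfolding metric_action_def by simp
    then show "?d p q = 0 \<longleftrightarrow> p = q"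
      using pq facts(1) sp by (cases p; cases q) (auto simp: add_nonneg_eq_0_iff)
  next
    fix p q r assume pqr: "p \<in> ?S" "q \<in> ?S" "r \<in> ?S"
    obtain x g x' g' x'' g'' where e: "p = (x, g)" "q = (x', g')" "r = (x'', g'')"
      by (metis surj_pair)
    have mem: "x \<in> mspace X" "x' \<in> mspace X" "x'' \<in> mspace X"
      "g \<in> carrier G" "g' \<in> carrier G" "g'' \<in> carrier G"
      using pqr e by auto
    have 1: "mdist D (F x x'' g) g'' \<le> mdist D (F x x'' g) (F x' x'' (F x x' g))
        + mdist D (F x' x'' (F x x' g)) g''"
      using mem facts(1) by (intro mdist_triangle) (auto simp: sp)
    have 2: "mdist D (F x' x'' (F x x' g)) g'' \<le> mdist D (F x' x'' (F x x' g)) (F x' x'' g')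
        + mdist D (F x' x'' g') g''"
      using mem facts(1) by (intro mdist_triangle) (auto simp: sp)
    have 3: "mdist D (F x' x'' (F x x' g)) (F x' x'' g') = mdist D (F x x' g) g'"
      using mem facts(1,2) by blast
    have 4: "mdist D (F x' x'' (F x x' g)) (F x x'' g)
        \<le> mdist X x x' + mdist X x' x'' - mdist X x x''"
      using assms mem unfolding metric_action_def by blast
    then have "mdist D (F x x'' g) (F x' x'' (F x x' g))
        \<le> mdist X x x' + mdist X x' x'' - mdist X x x''"
      by (metis mdist_commute)
    with 1 2 3 show "?d p r \<le> ?d p q + ?d q r"
      using mem e by simp
  qed auto
  show "mspace (total (groth X G D F)) = ?S"
    by (simp add: groth_def)
  show "\<lbrakk>x \<in> mspace X; x' \<in> mspace X; g \<in> carrier G; g' \<in> carrier G\<rbrakk> \<Longrightarrow>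
      mdist (total (groth X G D F)) (x, g) (x', g') = mdist X x x' + mdist D (F x x' g) g'"
    by (simp add: groth_def)
qed

definition groth_map ::
  "'x metric \<Rightarrow> ('g, 'b) monoid_scheme \<Rightarrow> ('x \<Rightarrow> 'g \<Rightarrow> 'g) \<Rightarrow> 'x \<times> 'g \<Rightarrow> 'x \<times> 'g" where
  "groth_map X G \<theta> = (\<lambda>p\<in>mspace X \<times> carrier G. (fst p, \<theta> (fst p) (snd p)))"

text \<open>Renaming the points of the total space along an injection \<open>\<iota>\<close> defined on the set \<open>S\<close> of
  these points.\<close>

definition rename_torsor ::
  "('p \<Rightarrow> 'e) \<Rightarrow> 'p set \<Rightarrow> ('g, 'b) monoid_scheme \<Rightarrow> ('x, 'g, 'p) torsor \<Rightarrow> ('x, 'g, 'e) torsor" where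
  "rename_torsor \<iota> S G T = \<lparr>
     total = metric (\<iota> ` S, \<lambda>e e'. mdist (total T) (inv_into S \<iota> e) (inv_into S \<iota> e')),
     proj = (\<lambda>e\<in>\<iota> ` S. proj T (inv_into S \<iota> e)),
     act = (\<lambda>e\<in>\<iota> ` S. \<lambda>h\<in>carrier G. \<iota> (act T (inv_into S \<iota> e) h))\<rparr>"

lemma rename_torsor_total:
  assumes "inj_on \<iota> S" "mspace (total T) = S"
  shows "mspace (total (rename_torsor \<iota> S G T)) = \<iota> ` S"
    and "\<lbrakk>p \<in> S; q \<in> S\<rbrakk> \<Longrightarrow>
      mdist (total (rename_torsor \<iota> S G T)) (\<iota> p) (\<iota> q) = mdist (total T) p q"
proof -
  interpret Metric_space "\<iota> ` S"
    "\<lambda>e e'. mdist (total T) (inv_into S \<iota> e) (inv_into S \<iota> e')"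
    using assms by unfold_locales (auto simp: mdist_commute mdist_triangle)
  show "mspace (total (rename_torsor \<iota> S G T)) = \<iota> ` S"
    "\<lbrakk>p \<in> S; q \<in> S\<rbrakk> \<Longrightarrow>
      mdist (total (rename_torsor \<iota> S G T)) (\<iota> p) (\<iota> q) = mdist (total T) p q"
    using assms by (simp_all add: rename_torsor_def)
qed

definition rename_map :: "('p \<Rightarrow> 'e) \<Rightarrow> 'p set \<Rightarrow> ('p \<Rightarrow> 'p) \<Rightarrow> 'e \<Rightarrow> 'e" where
  "rename_map \<iota> S \<phi> = (\<lambda>e\<in>\<iota> ` S. \<iota> (\<phi> (inv_into S \<iota> e)))"

text \<open>The points \<open>(x, g)\<close> of \<open>E(F)\<close> are represented in the universe \<open>'e\<close> as \<open>\<iota> (x, g)\<close>. For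
  \<open>'e = 'x \<times> 'g\<close> and \<open>\<iota> = id\<close> this is the Grothendieck construction verbatim.\<close>

definition grothendieck ::
  "'x metric \<Rightarrow> ('g, 'b) monoid_scheme \<Rightarrow> 'g metric \<Rightarrow> ('x \<times> 'g \<Rightarrow> 'e) \<Rightarrow>
   ('x \<Rightarrow> 'x \<Rightarrow> 'g \<Rightarrow> 'g, 'x \<Rightarrow> 'g \<Rightarrow> 'g, ('x, 'g, 'e) torsor, 'e \<Rightarrow> 'e) func" where
  "grothendieck X G D \<iota> = \<lparr>
     fobj = (\<lambda>F. rename_torsor \<iota> (mspace X \<times> carrier G) G (groth X G D F)),
     farr = (\<lambda>F F' \<theta>. rename_map \<iota> (mspace X \<times> carrier G) (groth_map X G \<theta>))\<rparr>"

end

theory Submission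
  imports Defs
begin

text \<open>
  A functor is an equivalence as soon as it is fully faithful and essentially surjective
  (\<open>equivalence_if_fully_faithful_ess_surj\<close>), so no inverse of the Grothendieck construction has to
  be written down.

  A torsor becomes a metric action once a base point \<open>s x\<close> is chosen in every fiber. The point of the
  fiber over \<open>x'\<close> nearest to \<open>s x\<close> is \<open>s x' \<cdot> f\<^bsub>xx'\<^esub>\<close> for a unique group element \<open>f\<^bsub>xx'\<^esub>\<close>. The fibration
  condition and the invariance of the metrics on the total space and on the group give
  \<open>d(s x \<cdot> g, s x' \<cdot> g') = d(x, x') + d(f\<^bsub>xx'\<^esub> g, g')\<close>, the metric of the Grothendieck construction
  (\<open>torsor_cocycle\<close>). From this formula, symmetry of the metric gives \<open>f\<^bsub>x'x\<^esub> = f\<^bsub>xx'\<^esub>\<inverse>\<close>, and the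
  triangle inequality for three points becomes the inequality demanded of a metric action. So every
  torsor is isomorphic to some \<open>E(F)\<close> (\<open>grothendieck_ess_surj\<close>).

  An equivariant map \<open>E(F) \<rightarrow> E(F')\<close> over \<open>X\<close> is determined by the images \<open>(x, t\<^bsub>x\<^esub>)\<close> of the points
  \<open>(x, 1)\<close>: it sends \<open>(x, g)\<close> to \<open>(x, t\<^bsub>x\<^esub> g)\<close>. The point \<open>(x', F\<^bsub>xx'\<^esub> g)\<close> is the one over \<open>x'\<close> at distance
  \<open>d(x, x')\<close> from \<open>(x, g)\<close>. A nonexpansive map over \<open>X\<close> preserves this property, so it must send
  that point to \<open>(x', F'\<^bsub>xx'\<^esub> (t\<^bsub>x\<^esub> g))\<close>. This is the naturality of left multiplication by \<open>t\<^bsub>x\<^esub>\<close>, so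
  the functor is full (\<open>grothendieck_full\<close>); it is faithful because a transformation can be read off
  from its values on points.
\<close>

section \<open>Fully faithful, essentially surjective functors\<close>

lemma category_ide_arr:
  "\<lbrakk>is_category C; a \<in> obj C\<rbrakk> \<Longrightarrow> ide C a \<in> arr C a a"
  by (simp add: is_category_def)

lemma category_cmp_arr:
  "\<lbrakk>is_category C; a \<in> obj C; b \<in> obj C; c \<in> obj C; f \<in> arr C a b; g \<in> arr C b c\<rbrakk>
    \<Longrightarrow> cmp C a b c g f \<in> arr C a c"
  by (simp add: is_category_def)

lemma category_ide_right:
  "\<lbrakk>is_category C; a \<in> obj C; b \<in> obj C; f \<in> arr C a b\<rbrakk> \<Longrightarrow> cmp C a a b f (ide C a) = f"
  by (simp add: is_category_def)

lemma category_ide_left: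
  "\<lbrakk>is_category C; a \<in> obj C; b \<in> obj C; f \<in> arr C a b\<rbrakk> \<Longrightarrow> cmp C a b b (ide C b) f = f"
  by (simp add: is_category_def)

lemma category_assoc:
  "\<lbrakk>is_category C; a \<in> obj C; b \<in> obj C; c \<in> obj C; d \<in> obj C;
    f \<in> arr C a b; g \<in> arr C b c; h \<in> arr C c d\<rbrakk>
    \<Longrightarrow> cmp C a c d h (cmp C a b c g f) = cmp C a b d (cmp C b c d h g) f"
  by (simp add: is_category_def)

lemmas category_rules =
  category_ide_arr category_cmp_arr category_ide_right category_ide_left

lemma functor_cmp:
  "\<lbrakk>is_functor C D F; a \<in> obj C; b \<in> obj C; c \<in> obj C; f \<in> arr C a b; g \<in> arr C b c\<rbrakk>
    \<Longrightarrow> farr F a c (cmp C a b c g f)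
      = cmp D (fobj F a) (fobj F b) (fobj F c) (farr F b c g) (farr F a b f)"
  by (simp add: is_functor_def)

lemma fully_faithful_reflects_iso:
  assumes F: "is_functor C D F"
    and ff: "\<And>a b. \<lbrakk>a \<in> obj C; b \<in> obj C\<rbrakk>
      \<Longrightarrow> bij_betw (farr F a b) (arr C a b) (arr D (fobj F a) (fobj F b))"
    and a: "a \<in> obj C" and b: "b \<in> obj C" and u: "u \<in> arr C a b"
    and iso: "is_iso D (fobj F a) (fobj F b) (farr F a b u)"
  shows "is_iso C a b u"
proof -
  have C: "is_category C" using F by (simp add: is_functor_def)
  obtain w where w: "w \<in> arr D (fobj F b) (fobj F a)"
    "cmp D (fobj F a) (fobj F b) (fobj F a) w (farr F a b u) = ide D (fobj F a)"
    "cmp D (fobj F b) (fobj F a) (fobj F b) (farr F a b u) w = ide D (fobj F b)"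
    using iso by (auto simp: is_iso_def)
  obtain v where v: "v \<in> arr C b a" "farr F b a v = w"
    using ff [OF b a] w(1) by (metis bij_betw_def imageE)
  have inj: "inj_on (farr F c c) (arr C c c)" if "c \<in> obj C" for c
    using ff that by (simp add: bij_betw_def)
  have Fide: "farr F c c (ide C c) = ide D (fobj F c)" if "c \<in> obj C" for c
    using F that by (simp add: is_functor_def)
  have "cmp C a b a v u = ide C a"
    by (rule inj_onD [OF inj [OF a]])
      (use a b u v w in \<open>simp_all add: functor_cmp [OF F] Fide category_rules [OF C]\<close>)
  moreover have "cmp C b a b u v = ide C b"
    by (rule inj_onD [OF inj [OF b]])
      (use a b u v w in \<open>simp_all add: functor_cmp [OF F] Fide category_rules [OF C]\<close>)
  ultimately show ?thesis using u v by (auto simp: is_iso_def)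
qed

text \<open>Choose for every \<open>d\<close> an isomorphism \<open>h d\<close> from some \<open>F (k d)\<close> to \<open>d\<close>. The inverse functor
  sends \<open>f : d \<rightarrow> e\<close> to the unique \<open>u : k d \<rightarrow> k e\<close> with \<open>h e \<circ> F u = f \<circ> h d\<close>. Defining it by this
  square, and not by a formula with the inverse of \<open>h e\<close>, makes functoriality a pasting of squares
  and makes \<open>h\<close> natural by definition.\<close>

lemma equivalence_if_fully_faithful_ess_surj:
  assumes F: "is_functor C D F"
    and ff: "\<And>a b. \<lbrakk>a \<in> obj C; b \<in> obj C\<rbrakk>
      \<Longrightarrow> bij_betw (farr F a b) (arr C a b) (arr D (fobj F a) (fobj F b))"
    and es: "\<And>d. d \<in> obj D \<Longrightarrow> \<exists>a\<in>obj C. \<exists>h. is_iso D (fobj F a) d h"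
  shows "is_equivalence C D F"
proof -
  have C: "is_category C" and D: "is_category D" using F by (simp_all add: is_functor_def)
  have Fo: "fobj F a \<in> obj D" if "a \<in> obj C" for a
    using F that by (simp add: is_functor_def)
  have Fa: "farr F a b f \<in> arr D (fobj F a) (fobj F b)"
    if "a \<in> obj C" "b \<in> obj C" "f \<in> arr C a b" for a b f
    using F that by (simp add: is_functor_def)
  have Fide: "farr F c c (ide C c) = ide D (fobj F c)" if "c \<in> obj C" for c
    using F that by (simp add: is_functor_def)
  note Fc = functor_cmp [OF F]
  obtain k h where k: "\<And>d. d \<in> obj D \<Longrightarrow> k d \<in> obj C"
    and h: "\<And>d. d \<in> obj D \<Longrightarrow> is_iso D (fobj F (k d)) d (h d)"
    using es by metis
  have ha: "h d \<in> arr D (fobj F (k d)) d" if "d \<in> obj D" for d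
    using h [OF that] by (simp add: is_iso_def)
  obtain h' where h': "\<And>d. d \<in> obj D \<Longrightarrow> h' d \<in> arr D d (fobj F (k d))"
    and h'h: "\<And>d. d \<in> obj D \<Longrightarrow>
      cmp D (fobj F (k d)) d (fobj F (k d)) (h' d) (h d) = ide D (fobj F (k d))"
    and hh': "\<And>d. d \<in> obj D \<Longrightarrow> cmp D d (fobj F (k d)) d (h d) (h' d) = ide D d"
    using h unfolding is_iso_def by metis
  have inj: "u = v" if "farr F a b u = farr F a b v" "a \<in> obj C" "b \<in> obj C"
    "u \<in> arr C a b" "v \<in> arr C a b" for a b u v
    using ff that by (meson bij_betw_def inj_onD)
  have lift: "\<exists>u\<in>arr C a b. farr F a b u = g"
    if "a \<in> obj C" "b \<in> obj C" "g \<in> arr D (fobj F a) (fobj F b)" for a b g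
    using ff [OF that(1,2)] that(3) by (metis bij_betw_def imageE)
  let ?sq = "\<lambda>d e f u. u \<in> arr C (k d) (k e) \<and>
    cmp D (fobj F (k d)) (fobj F (k e)) e (h e) (farr F (k d) (k e) u)
      = cmp D (fobj F (k d)) d e f (h d)"
  have ex: "\<exists>u. ?sq d e f u" if d: "d \<in> obj D" and e: "e \<in> obj D" and f: "f \<in> arr D d e" for d e f
  proof -
    let ?p = "cmp D (fobj F (k d)) d e f (h d)"
    have p: "?p \<in> arr D (fobj F (k d)) e"
      using d e f k ha Fo by (simp add: category_cmp_arr [OF D])
    obtain u where u: "u \<in> arr C (k d) (k e)"
      "farr F (k d) (k e) u = cmp D (fobj F (k d)) e (fobj F (k e)) (h' e) ?p"
      using lift [of "k d" "k e"] d e k p h' Fo by (metis category_cmp_arr [OF D])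
    have "cmp D (fobj F (k d)) (fobj F (k e)) e (h e) (farr F (k d) (k e) u)
        = cmp D (fobj F (k d)) e e (cmp D e (fobj F (k e)) e (h e) (h' e)) ?p"
      unfolding u(2) using d e k p ha h' Fo by (intro category_assoc [OF D]) auto
    then show ?thesis using u(1) hh' d e k p Fo by (auto simp: category_ide_left [OF D])
  qed
  \<comment> \<open>Composing the square with \<open>h' e\<close> recovers \<open>F u\<close>, and \<open>F\<close> is faithful.\<close>
  have uniq: "u = v" if d: "d \<in> obj D" and e: "e \<in> obj D" and u: "?sq d e f u" and v: "?sq d e f v"
    for d e f u v
  proof -
    have "cmp D (fobj F (k d)) e (fobj F (k e)) (h' e)
        (cmp D (fobj F (k d)) (fobj F (k e)) e (h e) (farr F (k d) (k e) w))
        = farr F (k d) (k e) w" if "w \<in> arr C (k d) (k e)" for w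
      using that d e k ha h' Fo Fa h'h
      by (simp add: category_assoc [OF D] category_ide_left [OF D])
    then have "farr F (k d) (k e) u = farr F (k d) (k e) v" using u v by metis
    then show ?thesis using inj d e k u v by blast
  qed
  define K where "K = \<lparr>fobj = k, farr = (\<lambda>d e f. SOME u. ?sq d e f u)\<rparr>"
  have Ko: "fobj K = k" by (simp add: K_def)
  have Ksq: "?sq d e f (farr K d e f)" if "d \<in> obj D" "e \<in> obj D" "f \<in> arr D d e" for d e f
    using someI_ex [OF ex [OF that]] by (simp add: K_def)
  have "is_functor D C K"
    unfolding is_functor_def Ko
  proof (intro conjI ballI C D)
    show "k d \<in> obj C" if "d \<in> obj D" for d using k that .
    show "farr K d e f \<in> arr C (k d) (k e)" if "d \<in> obj D" "e \<in> obj D" "f \<in> arr D d e" for d e f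
      using Ksq that by blast
    show "farr K d d (ide D d) = ide C (k d)" if d: "d \<in> obj D" for d
    proof (rule uniq [OF d d Ksq])
      show "?sq d d (ide D d) (ide C (k d))"
        using d k ha Fo by (simp add: Fide category_rules [OF C] category_rules [OF D])
    qed (use d in \<open>simp_all add: category_ide_arr [OF D]\<close>)
    show "farr K a c (cmp D a b c g f) = cmp C (k a) (k b) (k c) (farr K b c g) (farr K a b f)"
      if a: "a \<in> obj D" and b: "b \<in> obj D" and c: "c \<in> obj D"
        and f: "f \<in> arr D a b" and g: "g \<in> arr D b c" for a b c f g
    proof (rule uniq [OF a c Ksq])
      let ?u = "farr K a b f" and ?v = "farr K b c g"
      let ?A = "fobj F (k a)" and ?B = "fobj F (k b)" and ?C = "fobj F (k c)"
      let ?U = "farr F (k a) (k b) ?u" and ?V = "farr F (k b) (k c) ?v"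
      have u: "?u \<in> arr C (k a) (k b)" "cmp D ?A ?B b (h b) ?U = cmp D ?A a b f (h a)"
        using Ksq [OF a b f] by auto
      have v: "?v \<in> arr C (k b) (k c)" "cmp D ?B ?C c (h c) ?V = cmp D ?B b c g (h b)"
        using Ksq [OF b c g] by auto
      have o: "?A \<in> obj D" "?B \<in> obj D" "?C \<in> obj D" using a b c k Fo by auto
      have ar: "?U \<in> arr D ?A ?B" "?V \<in> arr D ?B ?C" using u v a b c k Fa by auto
      have "cmp D ?A ?C c (h c) (cmp D ?A ?B ?C ?V ?U) = cmp D ?A ?B c (cmp D ?B ?C c (h c) ?V) ?U"
        using o ar c ha by (intro category_assoc [OF D]) auto
      also have "\<dots> = cmp D ?A ?B c (cmp D ?B b c g (h b)) ?U" by (simp add: v(2))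
      also have "\<dots> = cmp D ?A b c g (cmp D ?A ?B b (h b) ?U)"
        using o ar b c ha g by (intro category_assoc [OF D, symmetric]) auto
      also have "\<dots> = cmp D ?A b c g (cmp D ?A a b f (h a))" by (simp add: u(2))
      also have "\<dots> = cmp D ?A a c (cmp D a b c g f) (h a)"
        using o a b c ha f g by (intro category_assoc [OF D]) auto
      finally show "?sq a c (cmp D a b c g f) (cmp C (k a) (k b) (k c) ?v ?u)"
        using a b c k u(1) v(1) by (simp add: Fc category_cmp_arr [OF C])
    qed (use a b c f g in \<open>simp_all add: category_cmp_arr [OF D]\<close>)
  qed
  moreover have "naturally_isomorphic D D (comp_func F K) id_func"
    unfolding naturally_isomorphic_def comp_func_def id_func_def
    using h Ksq by (intro exI [of _ h]) (simp add: Ko)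
  moreover have "naturally_isomorphic C C (comp_func K F) id_func"
  proof -
    have "\<exists>u. u \<in> arr C (k (fobj F a)) a \<and> farr F (k (fobj F a)) a u = h (fobj F a)"
      if "a \<in> obj C" for a
      using lift [of "k (fobj F a)" a "h (fobj F a)"] that k Fo ha by blast
    then obtain \<eta> where \<eta>: "\<And>a. a \<in> obj C \<Longrightarrow> \<eta> a \<in> arr C (k (fobj F a)) a"
      and F\<eta>: "\<And>a. a \<in> obj C \<Longrightarrow> farr F (k (fobj F a)) a (\<eta> a) = h (fobj F a)"
      by metis
    have "is_iso C (k (fobj F a)) a (\<eta> a)" if "a \<in> obj C" for a
      using that k Fo \<eta> F\<eta> h by (intro fully_faithful_reflects_iso [OF F ff]) auto
    moreover have "cmp C (k (fobj F a)) (k (fobj F b)) b (\<eta> b)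
          (farr K (fobj F a) (fobj F b) (farr F a b f))
        = cmp C (k (fobj F a)) a b f (\<eta> a)"
      if a: "a \<in> obj C" and b: "b \<in> obj C" and f: "f \<in> arr C a b" for a b f
    proof (rule inj)
      note sq = Ksq [OF Fo [OF a] Fo [OF b] Fa [OF a b f]]
      show "farr F (k (fobj F a)) b (cmp C (k (fobj F a)) (k (fobj F b)) b (\<eta> b)
            (farr K (fobj F a) (fobj F b) (farr F a b f)))
          = farr F (k (fobj F a)) b (cmp C (k (fobj F a)) a b f (\<eta> a))"
        using sq a b f k Fo \<eta> F\<eta> by (simp add: Fc)
    qed (use a b f k Fo Fa \<eta> Ksq in \<open>auto intro!: category_cmp_arr [OF C]\<close>)
    ultimately show ?thesis
      unfolding naturally_isomorphic_def comp_func_def id_func_def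
      by (intro exI [of _ \<eta>]) (simp add: Ko)
  qed
  ultimately show ?thesis using F by (auto simp: is_equivalence_def)
qed


section \<open>The categories of metric actions and of torsors\<close>

lemma left_mult_apply [simp]: "a \<in> carrier G \<Longrightarrow> left_mult G f a = f \<otimes>\<^bsub>G\<^esub> a"
  by (simp add: left_mult_def)

lemma metric_transformation_closed:
  assumes "group G" "metric_transformation X G F F' \<theta>" "x \<in> mspace X" "a \<in> carrier G"
  shows "\<theta> x a \<in> carrier G"
proof -
  interpret group G by fact
  obtain t where "t \<in> carrier G" "\<theta> x = left_mult G t"
    using assms unfolding metric_transformation_def by meson
  then show ?thesis using assms by simp
qed

lemma metric_transformation_extensional:
  "\<lbrakk>metric_transformation X G F F' \<theta>; x \<in> mspace X\<rbrakk> \<Longrightarrow> \<theta> x \<in> extensional (carrier G)"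
  unfolding metric_transformation_def left_mult_def by force

lemma metric_transformation_eqI:
  assumes "metric_transformation X G F F' \<theta>" "metric_transformation X G H H' \<theta>'"
    and "\<And>x a. \<lbrakk>x \<in> mspace X; a \<in> carrier G\<rbrakk> \<Longrightarrow> \<theta> x a = \<theta>' x a"
  shows "\<theta> = \<theta>'"
proof (rule extensionalityI)
  show "\<theta> \<in> extensional (mspace X)" "\<theta>' \<in> extensional (mspace X)"
    using assms by (auto simp: metric_transformation_def)
  show "\<theta> x = \<theta>' x" if "x \<in> mspace X" for x
    using assms that by (intro extensionalityI [of _ "carrier G"] metric_transformation_extensional)
qed

lemma metric_transformation_cmp:
  assumes MG: "metric_group G D" and F: "metric_action X G D F"
    and t: "metric_transformation X G F F' \<theta>" and t': "metric_transformation X G F' F'' \<theta>'"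
  shows "metric_transformation X G F F''
    (\<lambda>x\<in>mspace X. compose (carrier G) (\<theta>' x) (\<theta> x))"
proof -
  interpret group G using MG by (simp add: metric_group_def)
  have "\<exists>s\<in>carrier G. compose (carrier G) (\<theta>' x) (\<theta> x) = left_mult G s" if x: "x \<in> mspace X" for x
  proof -
    obtain u v where "u \<in> carrier G" "\<theta> x = left_mult G u" "v \<in> carrier G" "\<theta>' x = left_mult G v"
      using t t' x unfolding metric_transformation_def by meson
    then have "compose (carrier G) (\<theta>' x) (\<theta> x) = left_mult G (v \<otimes>\<^bsub>G\<^esub> u)"
      by (auto simp: compose_def left_mult_def m_assoc)
    then show ?thesis using \<open>u \<in> carrier G\<close> \<open>v \<in> carrier G\<close> by blast
  qed
  moreover have "\<theta> x a \<in> carrier G" if "x \<in> mspace X" "a \<in> carrier G" for x a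
    using metric_transformation_closed [OF is_group t that] .
  moreover have "F x x' a \<in> carrier G" if "x \<in> mspace X" "x' \<in> mspace X" "a \<in> carrier G" for x x' a
    using metric_action_facts(1) [OF MG F that(1,2,3,3)] .
  ultimately show ?thesis
    using t t' by (simp add: metric_transformation_def compose_def)
qed

lemma is_category_PMet:
  assumes MG: "metric_group G D"
  shows "is_category (PMet X G D)"
proof -
  have G: "group G" using MG by (simp add: metric_group_def)
  interpret group G by fact
  note ext = metric_transformation_extensional
  note closed = metric_transformation_closed [OF G]
  have 1: "metric_transformation X G F F (\<lambda>x\<in>mspace X. \<lambda>a\<in>carrier G. a)"
    if "metric_action X G D F" for F
  proof -
    have "(\<lambda>a\<in>carrier G. a) = left_mult G \<one>\<^bsub>G\<^esub>" by (auto simp: left_mult_def)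
    moreover have "F x x' a \<in> carrier G" if "x \<in> mspace X" "x' \<in> mspace X" "a \<in> carrier G" for x x' a
      using metric_action_facts(1) [OF MG \<open>metric_action X G D F\<close> that(1,2,3,3)] .
    ultimately show ?thesis unfolding metric_transformation_def by (auto intro: one_closed)
  qed
  show ?thesis
    unfolding is_category_def
  proof (intro conjI ballI)
    show "cmp (PMet X G D) F F'' F''' \<theta>'' (cmp (PMet X G D) F F' F'' \<theta>' \<theta>) =
          cmp (PMet X G D) F F' F''' (cmp (PMet X G D) F' F'' F''' \<theta>'' \<theta>') \<theta>"
      if "\<theta> \<in> arr (PMet X G D) F F'" for F F' F'' F''' \<theta> \<theta>' \<theta>''
    proof -
      have "\<theta> x a \<in> carrier G" if "x \<in> mspace X" "a \<in> carrier G" for x a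
        using closed \<open>\<theta> \<in> arr (PMet X G D) F F'\<close> that by (simp add: PMet_def)
      then show ?thesis by (auto simp: PMet_def compose_def fun_eq_iff)
    qed
    fix F F' \<theta> assume "\<theta> \<in> arr (PMet X G D) F F'"
    then have t: "metric_transformation X G F F' \<theta>" by (simp add: PMet_def)
    then have e: "\<theta> \<in> extensional (mspace X)" by (simp add: metric_transformation_def)
    show "cmp (PMet X G D) F F F' \<theta> (ide (PMet X G D) F) = \<theta>"
      using ext [OF t] by (intro extensionalityI [OF _ e])
        (auto simp: PMet_def compose_def extensional_def)
    show "cmp (PMet X G D) F F' F' (ide (PMet X G D) F') \<theta> = \<theta>"
      using ext [OF t] closed [OF t] by (intro extensionalityI [OF _ e])
        (auto simp: PMet_def compose_def extensional_def)
  qed (auto simp: PMet_def 1 intro: metric_transformation_cmp [OF MG])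
qed

lemma torsor_act_closed:
  "\<lbrakk>torsor_over X G D T; e \<in> mspace (total T); g \<in> carrier G\<rbrakk> \<Longrightarrow> act T e g \<in> mspace (total T)"
  by (simp add: torsor_over_def right_action_def)

lemma torsor_morphism_closed:
  "\<lbrakk>torsor_morphism G T T' \<phi>; e \<in> mspace (total T)\<rbrakk> \<Longrightarrow> \<phi> e \<in> mspace (total T')"
  by (auto simp: torsor_morphism_def lipschitz1_def)

lemma torsor_morphism_cmp:
  assumes T: "torsor_over X G D T"
    and \<phi>: "torsor_morphism G T T' \<phi>" and \<psi>: "torsor_morphism G T' T'' \<psi>"
  shows "torsor_morphism G T T'' (compose (mspace (total T)) \<psi> \<phi>)"
proof -
  let ?M = "mspace (total T)"
  have closed: "\<phi> e \<in> mspace (total T')" if "e \<in> ?M" for e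
    using torsor_morphism_closed [OF \<phi> that] .
  have "mdist (total T'') (\<psi> (\<phi> e)) (\<psi> (\<phi> e')) \<le> mdist (total T) e e'"
    if "e \<in> ?M" "e' \<in> ?M" for e e'
  proof -
    have "mdist (total T'') (\<psi> (\<phi> e)) (\<psi> (\<phi> e')) \<le> mdist (total T') (\<phi> e) (\<phi> e')"
      using \<psi> closed that by (simp add: torsor_morphism_def lipschitz1_def)
    also have "\<dots> \<le> mdist (total T) e e'"
      using \<phi> that by (simp add: torsor_morphism_def lipschitz1_def)
    finally show ?thesis .
  qed
  then have "lipschitz1 (total T) (total T'') (compose ?M \<psi> \<phi>)"
    using closed torsor_morphism_closed [OF \<psi>] by (simp add: lipschitz1_def compose_def)
  then show ?thesis
    using \<phi> \<psi> closed torsor_act_closed [OF T] by (simp add: torsor_morphism_def compose_eq)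
qed

lemma is_category_Tors: "is_category (Tors X G D)"
  unfolding is_category_def
proof (intro conjI ballI)
  fix T assume "T \<in> obj (Tors X G D)"
  then show "ide (Tors X G D) T \<in> arr (Tors X G D) T T"
    using torsor_act_closed [of X G D T]
    by (simp add: Tors_def torsor_morphism_def lipschitz1_def)
next
  fix T T' T'' T''' \<phi> \<psi> \<omega>
  assume "\<phi> \<in> arr (Tors X G D) T T'"
  then have "\<phi> \<in> mspace (total T) \<rightarrow> mspace (total T')"
    by (simp add: Tors_def torsor_morphism_def lipschitz1_def)
  then show "cmp (Tors X G D) T T'' T''' \<omega> (cmp (Tors X G D) T T' T'' \<psi> \<phi>)
      = cmp (Tors X G D) T T' T''' (cmp (Tors X G D) T' T'' T''' \<omega> \<psi>) \<phi>"
    by (simp add: Tors_def compose_assoc)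
next
  fix T T' \<phi> assume "\<phi> \<in> arr (Tors X G D) T T'"
  then have "torsor_morphism G T T' \<phi>" by (simp add: Tors_def)
  then have "\<phi> \<in> extensional (mspace (total T))" "\<phi> \<in> mspace (total T) \<rightarrow> mspace (total T')"
    by (simp_all add: torsor_morphism_def lipschitz1_def)
  then show "cmp (Tors X G D) T T T' \<phi> (ide (Tors X G D) T) = \<phi>"
    "cmp (Tors X G D) T T' T' (ide (Tors X G D) T') \<phi> = \<phi>"
    by (simp_all add: Tors_def compose_Id Id_compose)
qed (auto simp: Tors_def intro: torsor_morphism_cmp)

text \<open>The set-theoretic inverse inherits equivariance and compatibility with the projections, and it
  is nonexpansive because distances are preserved.\<close>

lemma is_iso_Tors_if_isometry:
  assumes T: "torsor_over X G D T" and \<phi>: "torsor_morphism G T T' \<phi>"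
    and iso: "isometry (total T) (total T') \<phi>"
  shows "is_iso (Tors X G D) T T' \<phi>"
proof -
  let ?M = "mspace (total T)" and ?M' = "mspace (total T')"
  have bij: "bij_betw \<phi> ?M ?M'" using iso by (simp add: isometry_def)
  define \<psi> where "\<psi> = (\<lambda>e\<in>?M'. inv_into ?M \<phi> e)"
  have \<psi>: "\<psi> (\<phi> e) = e" if "e \<in> ?M" for e
    using that bij by (simp add: \<psi>_def bij_betw_apply bij_betw_inv_into_left)
  have ex: "\<exists>e\<in>?M. e' = \<phi> e" if "e' \<in> ?M'" for e'
    using that bij by (auto simp: bij_betw_def)
  have "torsor_morphism G T' T \<psi>"
    unfolding torsor_morphism_def lipschitz1_def
  proof (intro conjI ballI)
    show "\<psi> \<in> extensional ?M'" by (simp add: \<psi>_def)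
    show "\<psi> \<in> ?M' \<rightarrow> ?M" using ex \<psi> by fastforce
    fix e' assume "e' \<in> ?M'"
    then obtain e where e: "e \<in> ?M" "e' = \<phi> e" using ex by blast
    then show "proj T (\<psi> e') = proj T' e'" using \<phi> \<psi> by (simp add: torsor_morphism_def)
    show "\<psi> (act T' e' g) = act T (\<psi> e') g" if "g \<in> carrier G" for g
    proof -
      have "act T' e' g = \<phi> (act T e g)" using \<phi> e that by (simp add: torsor_morphism_def)
      then show ?thesis using \<psi> e that torsor_act_closed [OF T] by simp
    qed
    fix e2' assume "e2' \<in> ?M'"
    then obtain e2 where "e2 \<in> ?M" "e2' = \<phi> e2" using ex by blast
    then show "mdist (total T) (\<psi> e') (\<psi> e2') \<le> mdist (total T') e' e2'"
      using e \<psi> iso by (simp add: isometry_def)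
  qed
  moreover have "compose ?M \<psi> \<phi> = (\<lambda>e\<in>?M. e)"
    using \<psi> by (auto simp: compose_def)
  moreover have "compose ?M' \<phi> \<psi> = (\<lambda>e\<in>?M'. e)"
    using \<psi> ex by (fastforce simp: compose_def)
  ultimately show ?thesis
    using \<phi> by (auto simp: is_iso_def Tors_def)
qed


section \<open>The Grothendieck construction is a functor\<close>

lemma mdist_self: "x \<in> mspace M \<Longrightarrow> mdist M x x = 0"
  by simp

text \<open>Translations are nonexpansive because multiplication is; the inverse translation gives the other
  inequality.\<close>

lemma metric_group_right_mult:
  assumes "metric_group G D" "f \<in> carrier G" "a \<in> carrier G" "b \<in> carrier G"
  shows "mdist D (a \<otimes>\<^bsub>G\<^esub> f) (b \<otimes>\<^bsub>G\<^esub> f) = mdist D a b"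
proof -
  interpret group G using assms by (simp add: metric_group_def)
  have sp: "mspace D = carrier G" using assms by (simp add: metric_group_def)
  have le: "mdist D (u \<otimes>\<^bsub>G\<^esub> h) (v \<otimes>\<^bsub>G\<^esub> h) \<le> mdist D u v"
    if "h \<in> carrier G" "u \<in> carrier G" "v \<in> carrier G" for h u v
  proof -
    have "mdist D (u \<otimes>\<^bsub>G\<^esub> h) (v \<otimes>\<^bsub>G\<^esub> h) \<le> mdist D u v + mdist D h h"
      using assms(1) that unfolding metric_group_def lipschitz1_def by fastforce
    moreover have "mdist D h h = 0" using that sp by simp
    ultimately show ?thesis by simp
  qed
  have "mdist D (a \<otimes>\<^bsub>G\<^esub> f \<otimes>\<^bsub>G\<^esub> inv\<^bsub>G\<^esub> f) (b \<otimes>\<^bsub>G\<^esub> f \<otimes>\<^bsub>G\<^esub> inv\<^bsub>G\<^esub> f) \<le> mdist D (a \<otimes>\<^bsub>G\<^esub> f) (b \<otimes>\<^bsub>G\<^esub> f)"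
    using assms by (intro le) auto
  then have "mdist D a b \<le> mdist D (a \<otimes>\<^bsub>G\<^esub> f) (b \<otimes>\<^bsub>G\<^esub> f)"
    using assms by (simp add: m_assoc)
  with le [of f a b] assms show ?thesis by simp
qed

text \<open>Left and right multiplications commute. This is what makes the right action on the Grothendieck
  construction isometric.\<close>

lemma metric_action_mult:
  assumes "group G" "metric_action X G D F" "x \<in> mspace X" "x' \<in> mspace X"
    and "a \<in> carrier G" "h \<in> carrier G"
  shows "F x x' (a \<otimes>\<^bsub>G\<^esub> h) = F x x' a \<otimes>\<^bsub>G\<^esub> h"
proof -
  interpret group G by fact
  obtain f where "f \<in> carrier G" "F x x' = left_mult G f"
    using assms unfolding metric_action_def by meson
  then show ?thesis using assms by (simp add: m_assoc)
qed

context
  fixes X :: "'x metric" and G :: "('g, 'b) monoid_scheme" and D :: "'g metric"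
    and \<iota> :: "'x \<times> 'g \<Rightarrow> 'e"
  assumes MG: "metric_group G D"
    and inj: "inj_on \<iota> (mspace X \<times> carrier G)"
begin

abbreviation "E \<equiv> fobj (grothendieck X G D \<iota>)"

interpretation group G using MG by (simp add: metric_group_def)

lemma mspace_group: "mspace D = carrier G"
  using MG by (simp add: metric_group_def)

lemma point_eq_iff:
  "\<lbrakk>x \<in> mspace X; g \<in> carrier G; x' \<in> mspace X; g' \<in> carrier G\<rbrakk>
    \<Longrightarrow> \<iota> (x, g) = \<iota> (x', g') \<longleftrightarrow> x = x' \<and> g = g'"
  using inj by (auto dest: inj_onD)

text \<open>The rules \<open>grothendieck_space\<close> to \<open>grothendieck_map\<close> compute all data of \<open>E F\<close> on the points
  \<open>\<iota> (x, g)\<close>, so that distances and actions can be handled as if the points were pairs.\<close>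

lemma grothendieck_space:
  "metric_action X G D F \<Longrightarrow> mspace (total (E F)) = \<iota> ` (mspace X \<times> carrier G)"
  using rename_torsor_total(1) [OF inj groth_total(1) [OF MG]] by (simp add: grothendieck_def)

lemma grothendieck_dist:
  "\<lbrakk>metric_action X G D F; x \<in> mspace X; x' \<in> mspace X; g \<in> carrier G; g' \<in> carrier G\<rbrakk>
    \<Longrightarrow> mdist (total (E F)) (\<iota> (x, g)) (\<iota> (x', g')) = mdist X x x' + mdist D (F x x' g) g'"
  by (simp add: grothendieck_def groth_total(2) [OF MG]
      rename_torsor_total(2) [OF inj groth_total(1) [OF MG]])

lemma grothendieck_proj:
  "\<lbrakk>x \<in> mspace X; g \<in> carrier G\<rbrakk> \<Longrightarrow> proj (E F) (\<iota> (x, g)) = x"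
  by (simp add: grothendieck_def rename_torsor_def groth_def inv_into_f_f [OF inj])

lemma grothendieck_act:
  "\<lbrakk>x \<in> mspace X; g \<in> carrier G; h \<in> carrier G\<rbrakk>
    \<Longrightarrow> act (E F) (\<iota> (x, g)) h = \<iota> (x, g \<otimes>\<^bsub>G\<^esub> h)"
  by (simp add: grothendieck_def rename_torsor_def groth_def inv_into_f_f [OF inj])

lemma grothendieck_map:
  "\<lbrakk>x \<in> mspace X; g \<in> carrier G\<rbrakk>
    \<Longrightarrow> farr (grothendieck X G D \<iota>) F F' \<theta> (\<iota> (x, g)) = \<iota> (x, \<theta> x g)"
  by (simp add: grothendieck_def rename_map_def groth_map_def inv_into_f_f [OF inj])

lemma grothendieck_map_extensional:
  "farr (grothendieck X G D \<iota>) F F' \<theta> \<in> extensional (\<iota> ` (mspace X \<times> carrier G))"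
  by (simp add: grothendieck_def rename_map_def)

lemma grothendieck_fiber:
  assumes "metric_action X G D F" "x \<in> mspace X"
  shows "fiber (total (E F)) (proj (E F)) x = (\<lambda>g. \<iota> (x, g)) ` carrier G"
  using assms by (force simp: fiber_def grothendieck_space grothendieck_proj)

text \<open>The lift of \<open>(x, g)\<close> to the fiber over \<open>x'\<close> is \<open>(x', F x x' g)\<close>: the second summand of the
  distance vanishes there, and nowhere else on this fiber.\<close>

lemma grothendieck_fibration:
  assumes F: "metric_action X G D F"
  shows "metric_fibration X (total (E F)) (proj (E F))"
  unfolding metric_fibration_def
proof (intro conjI ballI)
  note facts = metric_action_facts [OF MG F]
  show "lipschitz1 (total (E F)) X (proj (E F))"
    using F by (auto simp: lipschitz1_def grothendieck_space grothendieck_proj grothendieck_dist)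
  fix e x' assume "e \<in> mspace (total (E F))" and x': "x' \<in> mspace X"
  then obtain x g where x: "x \<in> mspace X" and g: "g \<in> carrier G" and e: "e = \<iota> (x, g)"
    using F by (auto simp: grothendieck_space)
  have Fg: "F x x' g \<in> carrier G" using facts(1) x x' g by blast
  have self: "mdist D (F x x' g) (F x x' g) = 0" using Fg mspace_group by simp
  show "\<exists>!ex. ex \<in> fiber (total (E F)) (proj (E F)) x' \<and>
      mdist (total (E F)) e ex = mdist X (proj (E F) e) x' \<and>
      (\<forall>e'\<in>fiber (total (E F)) (proj (E F)) x'.
        mdist (total (E F)) e e' = mdist (total (E F)) e ex + mdist (total (E F)) ex e')"
  proof (rule ex1I [of _ "\<iota> (x', F x x' g)"], intro conjI ballI)
    show "\<iota> (x', F x x' g) \<in> fiber (total (E F)) (proj (E F)) x'"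
      using Fg by (simp add: grothendieck_fiber [OF F x'])
    show "mdist (total (E F)) e (\<iota> (x', F x x' g)) = mdist X (proj (E F) e) x'"
      using x x' g Fg self by (simp add: e grothendieck_dist [OF F] grothendieck_proj)
    fix e' assume "e' \<in> fiber (total (E F)) (proj (E F)) x'"
    then obtain g' where "g' \<in> carrier G" "e' = \<iota> (x', g')"
      by (auto simp: grothendieck_fiber [OF F x'])
    moreover have "F x' x' (F x x' g) = F x x' g"
      using F x' Fg by (simp add: metric_action_def)
    ultimately show "mdist (total (E F)) e e'
        = mdist (total (E F)) e (\<iota> (x', F x x' g)) + mdist (total (E F)) (\<iota> (x', F x x' g)) e'"
      using x x' g Fg self by (simp add: e grothendieck_dist [OF F])
  next
    fix ex
    assume *: "ex \<in> fiber (total (E F)) (proj (E F)) x' \<and>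
      mdist (total (E F)) e ex = mdist X (proj (E F) e) x' \<and>
      (\<forall>e'\<in>fiber (total (E F)) (proj (E F)) x'.
        mdist (total (E F)) e e' = mdist (total (E F)) e ex + mdist (total (E F)) ex e')"
    then obtain g' where g': "g' \<in> carrier G" "ex = \<iota> (x', g')"
      by (auto simp: grothendieck_fiber [OF F x'])
    with * have "mdist D (F x x' g) g' = 0"
      using x x' g by (simp add: e grothendieck_dist [OF F] grothendieck_proj)
    then show "ex = \<iota> (x', F x x' g)" using g' Fg mspace_group by simp
  qed
qed

text \<open>The group acts isometrically by right invariance of its metric together with
  \<open>metric_action_mult\<close>. Within a fiber the distance is that of the group, and left invariance shows
  that the metric induced on the group is the given one.\<close>

lemma grothendieck_torsor:
  assumes F: "metric_action X G D F"
  shows "torsor_over X G D (E F)"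
proof -
  let ?T = "E F" and ?S = "mspace X \<times> carrier G"
  let ?M = "mspace (total ?T)"
  note sp = grothendieck_space [OF F]
  note dist = grothendieck_dist [OF F]
  have Fclosed: "F x x' a \<in> carrier G" if "x \<in> mspace X" "x' \<in> mspace X" "a \<in> carrier G" for x x' a
    using metric_action_facts(1) [OF MG F that(1,2,3,3)] .
  have Fself: "F x x a = a" if "x \<in> mspace X" "a \<in> carrier G" for x a
    using F that by (simp add: metric_action_def)
  have action: "right_action G ?M (act ?T)"
    by (auto simp: right_action_def sp grothendieck_act m_assoc)
  have isom: "mdist (total ?T) (act ?T e g) (act ?T e' g) = mdist (total ?T) e e'"
    if "e \<in> ?M" "e' \<in> ?M" "g \<in> carrier G" for e e' g
    using that Fclosed
    by (auto simp: sp grothendieck_act dist metric_action_mult [OF is_group F]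
        metric_group_right_mult [OF MG])
  have surj: "\<exists>e'\<in>fiber (total ?T) (proj ?T) (proj ?T e). e = act ?T e' g"
    if "e \<in> ?M" "g \<in> carrier G" for e g
  proof -
    obtain x a where "x \<in> mspace X" "a \<in> carrier G" "e = \<iota> (x, a)" using \<open>e \<in> ?M\<close> by (auto simp: sp)
    with that show ?thesis
      by (intro bexI [of _ "\<iota> (x, a \<otimes>\<^bsub>G\<^esub> inv\<^bsub>G\<^esub> g)"])
        (auto simp: grothendieck_act m_assoc grothendieck_fiber [OF F] grothendieck_proj)
  qed
  have proj: "proj ?T (act ?T e g) = proj ?T e" if "e \<in> ?M" "g \<in> carrier G" for e g
    using that by (auto simp: sp grothendieck_act grothendieck_proj)
  have closed: "act ?T e g \<in> ?M" if "e \<in> ?M" "g \<in> carrier G" for e g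
    using action that by (simp add: right_action_def)
  have inj_act: "e = e'" if "e \<in> ?M" "e' \<in> ?M" "g \<in> carrier G" "act ?T e g = act ?T e' g" for e e' g
    using isom [OF that(1-3)] that closed by (metis mdist_zero)
  have "isometry (total ?T) (total ?T) (\<lambda>e. act ?T e g)" if g: "g \<in> carrier G" for g
    unfolding isometry_def bij_betw_def
  proof (intro conjI ballI)
    show "inj_on (\<lambda>e. act ?T e g) ?M" using inj_act g by (blast intro: inj_onI)
    show "(\<lambda>e. act ?T e g) ` ?M = ?M"
      using closed surj g by (fastforce simp: fiber_def)
  qed (use isom g in auto)
  moreover have "right_torsor G (submetric (total ?T) (fiber (total ?T) (proj ?T) x)) (act ?T)"
    if x: "x \<in> mspace X" for x
  proof -
    let ?Y = "fiber (total ?T) (proj ?T) x"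
    have Y: "?Y = (\<lambda>g. \<iota> (x, g)) ` carrier G" by (rule grothendieck_fiber [OF F x])
    have YM: "?Y \<inter> ?M = ?Y" by (auto simp: fiber_def)
    have 1: "right_action G ?Y (act ?T)"
      using action proj by (auto simp: right_action_def fiber_def)
    have 2: "?Y \<noteq> {}" using Y by auto
    have 3: "g = \<one>\<^bsub>G\<^esub>" if "e \<in> ?Y" "g \<in> carrier G" "act ?T e g = e" for e g
      using that x by (auto simp: Y grothendieck_act point_eq_iff)
    have 4: "\<exists>g\<in>carrier G. act ?T e g = e'" if ee: "e \<in> ?Y" "e' \<in> ?Y" for e e'
    proof -
      obtain a b where "a \<in> carrier G" "e = \<iota> (x, a)" "b \<in> carrier G" "e' = \<iota> (x, b)"
        using ee by (auto simp: Y)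
      then show ?thesis using x
        by (intro bexI [of _ "inv\<^bsub>G\<^esub> a \<otimes>\<^bsub>G\<^esub> b"]) (auto simp: grothendieck_act m_assoc [symmetric])
    qed
    have 5: "isometry (submetric (total ?T) ?Y) (submetric (total ?T) ?Y) (\<lambda>e. act ?T e g)"
      if g: "g \<in> carrier G" for g
    proof -
      have "inj_on (\<lambda>e. act ?T e g) ?Y"
        using inj_act g by (auto simp: fiber_def intro: inj_onI)
      moreover have "(\<lambda>e. act ?T e g) ` ?Y = ?Y"
        using closed surj g proj by (fastforce simp: fiber_def)
      ultimately show ?thesis
        using isom g YM by (simp add: isometry_def bij_betw_def) (simp add: fiber_def)
    qed
    have 6: "mdist (total ?T) e (act ?T e g) = mdist (total ?T) e' (act ?T e' g)"
      if "e \<in> ?Y" "e' \<in> ?Y" "g \<in> carrier G" for e e' g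
    proof -
      have "mdist D a (a \<otimes>\<^bsub>G\<^esub> g) = mdist D \<one>\<^bsub>G\<^esub> g" if "a \<in> carrier G" for a
        using metric_group_left_mult [OF MG that one_closed \<open>g \<in> carrier G\<close>] that by simp
      then show ?thesis using that x by (auto simp: Y grothendieck_act dist Fself)
    qed
    show ?thesis
      unfolding right_torsor_def mspace_submetric mdist_submetric YM
      by (intro conjI ballI impI 1 2 3 4 5 6)
  qed
  moreover have "mdist D f g = mdist (total ?T) (act ?T e f) (act ?T e g)"
    if "e \<in> ?M" "f \<in> carrier G" "g \<in> carrier G" for e f g
    using that by (auto simp: sp grothendieck_act dist Fself metric_group_left_mult [OF MG])
  moreover have "proj ?T \<in> extensional ?M" "act ?T \<in> extensional ?M"
    unfolding sp by (simp_all add: grothendieck_def rename_torsor_def)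
  moreover have "\<forall>e\<in>?M. act ?T e \<in> extensional (carrier G)"
    unfolding sp by (simp add: grothendieck_def rename_torsor_def)
  ultimately show ?thesis
    using grothendieck_fibration [OF F] action proj by (simp add: torsor_over_def)
qed

text \<open>Naturality turns \<open>d (F' x x' (\<theta> x a), \<theta> x' b)\<close> into \<open>d (\<theta> x' (F x x' a), \<theta> x' b)\<close>, which is
  \<open>d (F x x' a, b)\<close> by left invariance; so the induced map even preserves distances.\<close>

lemma grothendieck_morphism:
  assumes F: "metric_action X G D F" and F': "metric_action X G D F'"
    and \<theta>: "metric_transformation X G F F' \<theta>"
  shows "torsor_morphism G (E F) (E F') (farr (grothendieck X G D \<iota>) F F' \<theta>)"
proof -
  let ?\<phi> = "farr (grothendieck X G D \<iota>) F F' \<theta>"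
  have closed: "\<theta> x a \<in> carrier G" if "x \<in> mspace X" "a \<in> carrier G" for x a
    using metric_transformation_closed [OF is_group \<theta> that] .
  have mult: "\<theta> x (a \<otimes>\<^bsub>G\<^esub> h) = \<theta> x a \<otimes>\<^bsub>G\<^esub> h"
    if x: "x \<in> mspace X" and "a \<in> carrier G" "h \<in> carrier G" for x a h
  proof -
    obtain t where "t \<in> carrier G" "\<theta> x = left_mult G t"
      using \<theta> x unfolding metric_transformation_def by meson
    then show ?thesis using that by (simp add: m_assoc)
  qed
  have isom: "mdist D (\<theta> x a) (\<theta> x b) = mdist D a b"
    if x: "x \<in> mspace X" and "a \<in> carrier G" "b \<in> carrier G" for x a b
  proof -
    obtain t where "t \<in> carrier G" "\<theta> x = left_mult G t"
      using \<theta> x unfolding metric_transformation_def by meson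
    then show ?thesis using that by (simp add: metric_group_left_mult [OF MG])
  qed
  have Fclosed: "F x x' a \<in> carrier G" if "x \<in> mspace X" "x' \<in> mspace X" "a \<in> carrier G" for x x' a
    using metric_action_facts(1) [OF MG F that(1,2,3,3)] .
  have "F' x x' (\<theta> x a) = \<theta> x' (F x x' a)"
    if "x \<in> mspace X" "x' \<in> mspace X" "a \<in> carrier G" for x x' a
    using \<theta> that by (simp add: metric_transformation_def)
  then have "lipschitz1 (total (E F)) (total (E F')) ?\<phi>"
    using closed Fclosed isom
    by (auto simp: lipschitz1_def grothendieck_space [OF F] grothendieck_space [OF F']
        grothendieck_map grothendieck_dist [OF F] grothendieck_dist [OF F'])
  then show ?thesis
    using closed mult grothendieck_map_extensional
    by (auto simp: torsor_morphism_def grothendieck_space [OF F] grothendieck_map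
        grothendieck_proj grothendieck_act)
qed

lemma is_functor_grothendieck:
  "is_functor (PMet X G D) (Tors X G D) (grothendieck X G D \<iota>)"
  unfolding is_functor_def
proof (intro conjI ballI)
  let ?E = "grothendieck X G D \<iota>" and ?S = "mspace X \<times> carrier G"
  show "is_category (PMet X G D)" by (rule is_category_PMet [OF MG])
  show "is_category (Tors X G D :: (('x, 'g, 'e) torsor, 'e \<Rightarrow> 'e) cat)"
    by (rule is_category_Tors)
  fix F assume "F \<in> obj (PMet X G D)"
  then have F: "metric_action X G D F" by (simp add: PMet_def)
  show "fobj ?E F \<in> obj (Tors X G D)" using grothendieck_torsor [OF F] by (simp add: Tors_def)
  show "farr ?E F F (ide (PMet X G D) F) = ide (Tors X G D) (fobj ?E F)"
    using grothendieck_map_extensional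
    by (intro extensionalityI [of _ "\<iota> ` ?S"])
      (auto simp: Tors_def PMet_def grothendieck_space [OF F] grothendieck_map)
  fix F' assume "F' \<in> obj (PMet X G D)"
  then have F': "metric_action X G D F'" by (simp add: PMet_def)
  fix \<theta> assume "\<theta> \<in> arr (PMet X G D) F F'"
  then have \<theta>: "metric_transformation X G F F' \<theta>" by (simp add: PMet_def)
  show "farr ?E F F' \<theta> \<in> arr (Tors X G D) (fobj ?E F) (fobj ?E F')"
    using grothendieck_morphism [OF F F' \<theta>] by (simp add: Tors_def)
  fix F'' \<theta>'
  show "farr ?E F F'' (cmp (PMet X G D) F F' F'' \<theta>' \<theta>)
      = cmp (Tors X G D) (fobj ?E F) (fobj ?E F') (fobj ?E F'') (farr ?E F' F'' \<theta>') (farr ?E F F' \<theta>)"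
    using grothendieck_map_extensional metric_transformation_closed [OF is_group \<theta>]
    by (intro extensionalityI [of _ "\<iota> ` ?S"])
      (auto simp: Tors_def PMet_def grothendieck_space [OF F] grothendieck_map compose_def)
qed


section \<open>Full faithfulness\<close>

text \<open>The component of the transformation at \<open>x\<close> is left multiplication by the group coordinate
  \<open>t x\<close> of the image of \<open>(x, 1)\<close>; equivariance then gives the map at all points. Naturality comes
  from the Lipschitz bound, applied to the pairs of points at which the group part of the distance
  vanishes.\<close>

lemma grothendieck_full:
  assumes F: "metric_action X G D F" and F': "metric_action X G D F'"
    and \<phi>: "torsor_morphism G (E F) (E F') \<phi>"
  shows "\<exists>\<theta>. metric_transformation X G F F' \<theta> \<and> farr (grothendieck X G D \<iota>) F F' \<theta> = \<phi>"
proof -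
  note sp = grothendieck_space [OF F]
  have "\<exists>t\<in>carrier G. \<phi> (\<iota> (x, \<one>\<^bsub>G\<^esub>)) = \<iota> (x, t)" if x: "x \<in> mspace X" for x
  proof -
    have mem: "\<iota> (x, \<one>\<^bsub>G\<^esub>) \<in> mspace (total (E F))" using x by (auto simp: sp)
    then obtain y t where yt: "y \<in> mspace X" "t \<in> carrier G" "\<phi> (\<iota> (x, \<one>\<^bsub>G\<^esub>)) = \<iota> (y, t)"
      using torsor_morphism_closed [OF \<phi> mem] by (auto simp: grothendieck_space [OF F'])
    have "proj (E F') (\<phi> (\<iota> (x, \<one>\<^bsub>G\<^esub>))) = proj (E F) (\<iota> (x, \<one>\<^bsub>G\<^esub>))"
      using \<phi> mem by (simp add: torsor_morphism_def)
    then have "y = x" using x yt by (simp add: grothendieck_proj)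
    then show ?thesis using yt by blast
  qed
  then obtain t where t: "\<And>x. x \<in> mspace X \<Longrightarrow> t x \<in> carrier G"
    and t1: "\<And>x. x \<in> mspace X \<Longrightarrow> \<phi> (\<iota> (x, \<one>\<^bsub>G\<^esub>)) = \<iota> (x, t x)"
    by metis
  have \<phi>_eq: "\<phi> (\<iota> (x, g)) = \<iota> (x, t x \<otimes>\<^bsub>G\<^esub> g)" if x: "x \<in> mspace X" and g: "g \<in> carrier G" for x g
  proof -
    have "\<phi> (act (E F) (\<iota> (x, \<one>\<^bsub>G\<^esub>)) g) = act (E F') (\<phi> (\<iota> (x, \<one>\<^bsub>G\<^esub>))) g"
      using \<phi> x g by (simp add: torsor_morphism_def sp)
    then show ?thesis using x g t by (simp add: t1 grothendieck_act)
  qed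
  define \<theta> where "\<theta> = (\<lambda>x\<in>mspace X. left_mult G (t x))"
  have "F' x x' (t x \<otimes>\<^bsub>G\<^esub> a) = t x' \<otimes>\<^bsub>G\<^esub> F x x' a"
    if x: "x \<in> mspace X" and x': "x' \<in> mspace X" and a: "a \<in> carrier G" for x x' a
  proof -
    have Fa: "F x x' a \<in> carrier G" using metric_action_facts(1) [OF MG F x x' a a] .
    have F'a: "F' x x' (t x \<otimes>\<^bsub>G\<^esub> a) \<in> carrier G"
      using metric_action_facts(1) [OF MG F' x x'] t [OF x] a by blast
    \<comment> \<open>\<open>(x', F x x' a)\<close> is the lift of \<open>(x, a)\<close>, so the distance on the right is just \<open>d (x, x')\<close>.\<close>
    have "mdist (total (E F')) (\<phi> (\<iota> (x, a))) (\<phi> (\<iota> (x', F x x' a)))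
        \<le> mdist (total (E F)) (\<iota> (x, a)) (\<iota> (x', F x x' a))"
      using \<phi> x x' a Fa by (simp add: torsor_morphism_def lipschitz1_def sp)
    then have "mdist D (F' x x' (t x \<otimes>\<^bsub>G\<^esub> a)) (t x' \<otimes>\<^bsub>G\<^esub> F x x' a) \<le> mdist D (F x x' a) (F x x' a)"
      using x x' a Fa t by (simp add: \<phi>_eq grothendieck_dist [OF F] grothendieck_dist [OF F'])
    also have "\<dots> = 0" using Fa mspace_group by simp
    finally have "mdist D (F' x x' (t x \<otimes>\<^bsub>G\<^esub> a)) (t x' \<otimes>\<^bsub>G\<^esub> F x x' a) = 0"
      by (simp add: order_antisym)
    then show ?thesis using F'a Fa t x' mspace_group by simp
  qed
  moreover have "F x x' a \<in> carrier G"
    if "x \<in> mspace X" "x' \<in> mspace X" "a \<in> carrier G" for x x' a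
    using metric_action_facts(1) [OF MG F that(1,2,3,3)] .
  ultimately have "metric_transformation X G F F' \<theta>"
    using t by (auto simp: metric_transformation_def \<theta>_def)
  moreover have "farr (grothendieck X G D \<iota>) F F' \<theta> = \<phi>"
  proof (rule extensionalityI [OF grothendieck_map_extensional])
    show "\<phi> \<in> extensional (\<iota> ` (mspace X \<times> carrier G))"
      using \<phi> by (simp add: torsor_morphism_def sp)
  qed (auto simp: grothendieck_map \<phi>_eq \<theta>_def)
  ultimately show ?thesis by blast
qed

lemma grothendieck_faithful:
  assumes \<theta>: "metric_transformation X G F F' \<theta>" and \<theta>': "metric_transformation X G F F' \<theta>'"
    and eq: "farr (grothendieck X G D \<iota>) F F' \<theta> = farr (grothendieck X G D \<iota>) F F' \<theta>'"
  shows "\<theta> = \<theta>'"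
proof (rule metric_transformation_eqI [OF \<theta> \<theta>'])
  fix x a assume xa: "x \<in> mspace X" "a \<in> carrier G"
  have "\<iota> (x, \<theta> x a) = \<iota> (x, \<theta>' x a)"
    using eq xa by (metis grothendieck_map)
  then show "\<theta> x a = \<theta>' x a"
    using xa metric_transformation_closed [OF is_group \<theta> xa]
      metric_transformation_closed [OF is_group \<theta>' xa] by (simp add: point_eq_iff)
qed


section \<open>Essential surjectivity\<close>

text \<open>The element \<open>f x x'\<close> records, relative to the base points \<open>s\<close>, where the fibration lifts \<open>s x\<close> in
  the fiber over \<open>x'\<close>. The distance formula is immediate for \<open>g = 1\<close>; the general case reduces to
  it because the action is isometric.\<close>

lemma torsor_cocycle:
  assumes T: "torsor_over X G D T"
  obtains s f where "\<And>x. x \<in> mspace X \<Longrightarrow> s x \<in> fiber (total T) (proj T) x"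
    and "\<And>x x'. \<lbrakk>x \<in> mspace X; x' \<in> mspace X\<rbrakk> \<Longrightarrow> f x x' \<in> carrier G"
    and "\<And>x x' g g'. \<lbrakk>x \<in> mspace X; x' \<in> mspace X; g \<in> carrier G; g' \<in> carrier G\<rbrakk>
      \<Longrightarrow> mdist (total T) (act T (s x) g) (act T (s x') g')
        = mdist X x x' + mdist D (f x x' \<otimes>\<^bsub>G\<^esub> g) g'"
proof -
  let ?M = "mspace (total T)" and ?d = "mdist (total T)" and ?Y = "fiber (total T) (proj T)"
  have YM: "?Y x \<inter> ?M = ?Y x" for x by (auto simp: fiber_def)
  have tors: "right_torsor G (submetric (total T) (?Y x)) (act T)" if "x \<in> mspace X" for x
    using T that by (simp add: torsor_over_def)
  have "\<exists>e. e \<in> ?Y x" if "x \<in> mspace X" for x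
    using tors [OF that] by (auto simp: right_torsor_def)
  then obtain s where s: "\<And>x. x \<in> mspace X \<Longrightarrow> s x \<in> ?Y x" by metis
  have sM: "s x \<in> ?M" "proj T (s x) = x" if "x \<in> mspace X" for x
    using s [OF that] by (auto simp: fiber_def)
  have "\<exists>f\<in>carrier G. \<forall>e\<in>?Y x'. ?d (s x) e = mdist X x x' + ?d (act T (s x') f) e"
    if x: "x \<in> mspace X" and x': "x' \<in> mspace X" for x x'
  proof -
    have "metric_fibration X (total T) (proj T)" using T by (simp add: torsor_over_def)
    then obtain p where p: "p \<in> ?Y x'" "?d (s x) p = mdist X x x'"
      "\<forall>e\<in>?Y x'. ?d (s x) e = ?d (s x) p + ?d p e"
      using sM [OF x] x' unfolding metric_fibration_def by metis
    have "\<exists>f\<in>carrier G. act T (s x') f = p"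
      using tors [OF x'] s [OF x'] p(1) by (simp add: right_torsor_def YM)
    then obtain f where "f \<in> carrier G" "act T (s x') f = p" by blast
    then show ?thesis using p by metis
  qed
  then obtain f where f: "\<And>x x'. \<lbrakk>x \<in> mspace X; x' \<in> mspace X\<rbrakk> \<Longrightarrow> f x x' \<in> carrier G"
    and split: "\<And>x x' e. \<lbrakk>x \<in> mspace X; x' \<in> mspace X; e \<in> ?Y x'\<rbrakk>
      \<Longrightarrow> ?d (s x) e = mdist X x x' + ?d (act T (s x') (f x x')) e"
    by metis
  have "?d (act T (s x) g) (act T (s x') g') = mdist X x x' + mdist D (f x x' \<otimes>\<^bsub>G\<^esub> g) g'"
    if x: "x \<in> mspace X" and x': "x' \<in> mspace X" and g: "g \<in> carrier G" and g': "g' \<in> carrier G"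
    for x x' g g'
  proof -
    \<comment> \<open>Acting with the inverse of \<open>g\<close> moves the first point to the base point \<open>s x\<close>.\<close>
    let ?h = "g' \<otimes>\<^bsub>G\<^esub> inv\<^bsub>G\<^esub> g"
    have h: "?h \<in> carrier G" "?h \<otimes>\<^bsub>G\<^esub> g = g'" using g g' by (simp_all add: m_assoc)
    have sh: "act T (s x') ?h \<in> ?Y x'" "act T (s x') ?h \<in> ?M"
      using T sM [OF x'] h(1) by (auto simp: fiber_def torsor_over_def right_action_def)
    have "act T (act T (s x') ?h) g = act T (s x') (?h \<otimes>\<^bsub>G\<^esub> g)"
      using T sM(1) [OF x'] h(1) g by (simp add: torsor_over_def right_action_def)
    then have "?d (act T (s x) g) (act T (s x') g') = ?d (act T (s x) g) (act T (act T (s x') ?h) g)"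
      by (simp add: h(2))
    also have "\<dots> = ?d (s x) (act T (s x') ?h)"
      using T sM(1) [OF x] sh(2) g by (simp add: torsor_over_def isometry_def)
    also have "\<dots> = mdist X x x' + mdist D (f x x') ?h"
      using T sM(1) [OF x'] f [OF x x'] h(1) by (simp add: split [OF x x' sh(1)] torsor_over_def)
    also have "mdist D (f x x') ?h = mdist D (f x x' \<otimes>\<^bsub>G\<^esub> g) g'"
      using metric_group_right_mult [OF MG g f [OF x x'] h(1)] h(2) by simp
    finally show ?thesis .
  qed
  with s f that show ?thesis by blast
qed

lemma inv_into_left_mult:
  assumes "f \<in> carrier G" "a \<in> carrier G"
  shows "inv_into (carrier G) (left_mult G f) a = inv\<^bsub>G\<^esub> f \<otimes>\<^bsub>G\<^esub> a"
proof (rule inv_into_f_eq)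
  show "inj_on (left_mult G f) (carrier G)" using assms(1) by (simp add: inj_on_def)
qed (use assms in \<open>simp_all add: m_assoc [symmetric]\<close>)

text \<open>The cocycle \<open>f\<close> of \<open>torsor_cocycle\<close> is a metric action: each axiom is a property of the metric
  on the total space, read through the distance formula. The isomorphism sends \<open>(x, g)\<close> to
  \<open>s x \<cdot> g\<close>; it is isometric by the same formula and onto by transitivity on the fibers.\<close>

lemma grothendieck_ess_surj:
  assumes T: "torsor_over X G D T"
  shows "\<exists>F. metric_action X G D F \<and> (\<exists>\<psi>. is_iso (Tors X G D) (E F) T \<psi>)"
proof -
  let ?M = "mspace (total T)" and ?d = "mdist (total T)"
  obtain s f where s: "\<And>x. x \<in> mspace X \<Longrightarrow> s x \<in> fiber (total T) (proj T) x"
    and f: "\<And>x x'. \<lbrakk>x \<in> mspace X; x' \<in> mspace X\<rbrakk> \<Longrightarrow> f x x' \<in> carrier G"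
    and dist: "\<And>x x' g g'. \<lbrakk>x \<in> mspace X; x' \<in> mspace X; g \<in> carrier G; g' \<in> carrier G\<rbrakk>
      \<Longrightarrow> ?d (act T (s x) g) (act T (s x') g') = mdist X x x' + mdist D (f x x' \<otimes>\<^bsub>G\<^esub> g) g'"
    using torsor_cocycle [OF T] by blast
  have sM: "s x \<in> ?M" "proj T (s x) = x" if "x \<in> mspace X" for x
    using s [OF that] by (auto simp: fiber_def)
  have actM: "act T (s x) g \<in> ?M" if "x \<in> mspace X" "g \<in> carrier G" for x g
    using torsor_act_closed [OF T sM(1)] that by blast
  \<comment> \<open>The distance from \<open>s x\<close> to itself is zero.\<close>
  have f_self: "f x x = \<one>\<^bsub>G\<^esub>" if x: "x \<in> mspace X" for x
  proof -
    have "?d (act T (s x) \<one>\<^bsub>G\<^esub>) (act T (s x) \<one>\<^bsub>G\<^esub>) = 0" using actM [OF x one_closed] by simp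
    then show ?thesis
      using dist [OF x x one_closed one_closed] x f [OF x x] mspace_group mdist_self [OF x] by simp
  qed
  \<comment> \<open>Symmetry: \<open>s x' \<cdot> f x x'\<close> is at distance \<open>d (x, x')\<close> from \<open>s x\<close>, so in the reverse
    direction the group part of the distance vanishes.\<close>
  have f_inv: "f x' x = inv\<^bsub>G\<^esub> (f x x')" if x: "x \<in> mspace X" and x': "x' \<in> mspace X" for x x'
  proof -
    have "?d (act T (s x) \<one>\<^bsub>G\<^esub>) (act T (s x') (f x x')) = mdist X x x'"
      using dist [OF x x' one_closed f [OF x x']] f [OF x x'] mspace_group
      by (simp add: mdist_self)
    moreover have "?d (act T (s x') (f x x')) (act T (s x) \<one>\<^bsub>G\<^esub>)
        = mdist X x' x + mdist D (f x' x \<otimes>\<^bsub>G\<^esub> f x x') \<one>\<^bsub>G\<^esub>"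
      by (rule dist [OF x' x f [OF x x'] one_closed])
    ultimately have "mdist D (f x' x \<otimes>\<^bsub>G\<^esub> f x x') \<one>\<^bsub>G\<^esub> = 0"
      by (simp add: mdist_commute)
    then have "f x' x \<otimes>\<^bsub>G\<^esub> f x x' = \<one>\<^bsub>G\<^esub>" using f x x' mspace_group by simp
    then show ?thesis using f x x' by (simp add: inv_equality)
  qed
  \<comment> \<open>The triangle inequality through the successive lifts of \<open>s x \<cdot> a\<close> over \<open>x'\<close> and \<open>x''\<close>.\<close>
  have f_cocycle: "mdist D (f x' x'' \<otimes>\<^bsub>G\<^esub> (f x x' \<otimes>\<^bsub>G\<^esub> a)) (f x x'' \<otimes>\<^bsub>G\<^esub> a)
      \<le> mdist X x x' + mdist X x' x'' - mdist X x x''"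
    if x: "x \<in> mspace X" and x': "x' \<in> mspace X" and x'': "x'' \<in> mspace X" and a: "a \<in> carrier G"
    for x x' x'' a
  proof -
    let ?b = "f x x' \<otimes>\<^bsub>G\<^esub> a"
    let ?c = "f x' x'' \<otimes>\<^bsub>G\<^esub> ?b"
    have b: "?b \<in> carrier G" and c: "?c \<in> carrier G" using f x x' x'' a by simp_all
    have "?d (act T (s x) a) (act T (s x'') ?c)
        \<le> ?d (act T (s x) a) (act T (s x') ?b) + ?d (act T (s x') ?b) (act T (s x'') ?c)"
      using actM x x' x'' a b c by (intro mdist_triangle) auto
    moreover have "mdist D ?b ?b = 0" "mdist D ?c ?c = 0" using b c mspace_group by simp_all
    ultimately show ?thesis
      using dist [OF x x'' a c] dist [OF x x' a b] dist [OF x' x'' b c]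
        mdist_commute [of D ?c "f x x'' \<otimes>\<^bsub>G\<^esub> a"] by linarith
  qed
  define F where "F = (\<lambda>x\<in>mspace X. \<lambda>x'\<in>mspace X. left_mult G (f x x'))"
  have F_eq: "F x x' = left_mult G (f x x')" if "x \<in> mspace X" "x' \<in> mspace X" for x x'
    using that by (simp add: F_def)
  have F: "metric_action X G D F"
    unfolding metric_action_def
  proof (intro conjI ballI)
    show "F \<in> extensional (mspace X)" by (simp add: F_def)
    show "F x \<in> extensional (mspace X)" if "x \<in> mspace X" for x using that by (simp add: F_def)
    show "\<exists>g\<in>carrier G. F x x' = left_mult G g" if "x \<in> mspace X" "x' \<in> mspace X" for x x'
      using f F_eq that by blast
    show "F x x a = a" if "x \<in> mspace X" "a \<in> carrier G" for x a
      using that by (simp add: F_eq f_self)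
    show "F x' x a = inv_into (carrier G) (F x x') a"
      if "x \<in> mspace X" "x' \<in> mspace X" "a \<in> carrier G" for x x' a
      using that f by (simp add: F_eq inv_into_left_mult f_inv [of x x'])
    show "mdist D (F x' x'' (F x x' a)) (F x x'' a) \<le> mdist X x x' + mdist X x' x'' - mdist X x x''"
      if "x \<in> mspace X" "x' \<in> mspace X" "x'' \<in> mspace X" "a \<in> carrier G" for x x' x'' a
      using that f f_cocycle by (simp add: F_eq)
  qed
  let ?S = "mspace X \<times> carrier G"
  define \<psi> where "\<psi> = (\<lambda>e\<in>\<iota> ` ?S. act T (s (fst (inv_into ?S \<iota> e))) (snd (inv_into ?S \<iota> e)))"
  have \<psi>: "\<psi> (\<iota> (x, g)) = act T (s x) g" if "x \<in> mspace X" "g \<in> carrier G" for x g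
    using that by (simp add: \<psi>_def inv_into_f_f [OF inj])
  note sp = grothendieck_space [OF F]
  have \<psi>_dist: "?d (\<psi> e) (\<psi> e') = mdist (total (E F)) e e'"
    if "e \<in> mspace (total (E F))" "e' \<in> mspace (total (E F))" for e e'
    using that by (auto simp: sp \<psi> dist grothendieck_dist [OF F] F_eq)
  have \<psi>M: "\<psi> e \<in> ?M" if "e \<in> mspace (total (E F))" for e
    using that actM by (auto simp: sp \<psi>)
  have "isometry (total (E F)) (total T) \<psi>"
    unfolding isometry_def bij_betw_def
  proof (intro conjI ballI \<psi>_dist)
    show "inj_on \<psi> (mspace (total (E F)))"
      by (rule inj_onI) (metis \<psi>M \<psi>_dist mdist_zero)
    have "e \<in> \<psi> ` mspace (total (E F))" if e: "e \<in> ?M" for e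
    proof -
      let ?x = "proj T e"
      have x: "?x \<in> mspace X"
        using T e by (auto simp: torsor_over_def metric_fibration_def lipschitz1_def)
      have "e \<in> fiber (total T) (proj T) ?x \<inter> ?M" using e by (simp add: fiber_def)
      moreover have "s ?x \<in> fiber (total T) (proj T) ?x \<inter> ?M" using s [OF x] sM [OF x] by simp
      moreover have "right_torsor G (submetric (total T) (fiber (total T) (proj T) ?x)) (act T)"
        using T x by (simp add: torsor_over_def)
      ultimately have "\<exists>g\<in>carrier G. act T (s ?x) g = e" by (simp add: right_torsor_def)
      then obtain g where "g \<in> carrier G" "act T (s ?x) g = e" by blast
      then show ?thesis using x by (force simp: sp \<psi>)
    qed
    then show "\<psi> ` mspace (total (E F)) = ?M" using \<psi>M by blast
  qed
  moreover have "torsor_morphism G (E F) T \<psi>"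
    unfolding torsor_morphism_def
  proof (intro conjI ballI)
    show "\<psi> \<in> extensional (mspace (total (E F)))" by (simp add: sp \<psi>_def)
    show "lipschitz1 (total (E F)) (total T) \<psi>" using \<psi>M \<psi>_dist by (simp add: lipschitz1_def)
    fix e assume "e \<in> mspace (total (E F))"
    then obtain x a where x: "x \<in> mspace X" and a: "a \<in> carrier G" and e: "e = \<iota> (x, a)"
      by (auto simp: sp)
    show "proj T (\<psi> e) = proj (E F) e"
      using T x a sM by (simp add: e \<psi> grothendieck_proj torsor_over_def)
    show "\<psi> (act (E F) e g) = act T (\<psi> e) g" if g: "g \<in> carrier G" for g
      using T x a g sM by (simp add: e \<psi> grothendieck_act torsor_over_def right_action_def)
  qed
  ultimately have "is_iso (Tors X G D) (E F) T \<psi>"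
    using grothendieck_torsor [OF F] by (blast intro: is_iso_Tors_if_isometry)
  with F show ?thesis by blast
qed

end


section \<open>The equivalence\<close>

theorem theorem1p2:
  fixes X :: "'x metric" and G :: "('g, 'b) monoid_scheme" and D :: "'g metric"
    and \<iota> :: "'x \<times> 'g \<Rightarrow> 'e"
  assumes "metric_group G D"
    and "inj_on \<iota> (mspace X \<times> carrier G)"
  shows "is_equivalence (PMet X G D) (Tors X G D) (grothendieck X G D \<iota>)"
proof (rule equivalence_if_fully_faithful_ess_surj)
  let ?E = "grothendieck X G D \<iota>"
  show "is_functor (PMet X G D) (Tors X G D) ?E"
    by (rule is_functor_grothendieck [OF assms])
  show "bij_betw (farr ?E F F') (arr (PMet X G D) F F') (arr (Tors X G D) (fobj ?E F) (fobj ?E F'))"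
    if "F \<in> obj (PMet X G D)" "F' \<in> obj (PMet X G D)" for F F'
  proof -
    have F: "metric_action X G D F" and F': "metric_action X G D F'"
      using that by (simp_all add: PMet_def)
    have "inj_on (farr ?E F F') (arr (PMet X G D) F F')"
      by (rule inj_onI) (simp add: PMet_def grothendieck_faithful [OF assms])
    moreover have "farr ?E F F' ` arr (PMet X G D) F F' = arr (Tors X G D) (fobj ?E F) (fobj ?E F')"
      using grothendieck_morphism [OF assms F F'] grothendieck_full [OF assms F F']
      by (force simp: PMet_def Tors_def)
    ultimately show ?thesis by (simp add: bij_betw_def)
  qed
  show "\<exists>F\<in>obj (PMet X G D). \<exists>h. is_iso (Tors X G D) (fobj ?E F) T h"
    if "T \<in> obj (Tors X G D)" for T
    using grothendieck_ess_surj [OF assms, of T] that by (auto simp: PMet_def Tors_def)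
qed

end
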